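(* For every $\varepsilon, \eta > 0$, there are $c > 0$ and $n_0$ such that every graph $G$ on $n \geq n_0$ vertices with minimum degree $\delta(G) \geq (1/2 + \varepsilon)n$ contains, as a (not necessarily induced) subgraph, a vertex-spanning blow-up of a cycle in which each cluster has size in the range $(1 \pm \eta)\, c \log n$, that is, between $(1-\eta)c\log n$ and $(1+\eta)c\log n$.
   Context: A (complete) blow-up of a graph $F$ is obtained by replacing the vertices of $F$ with pairwise vertex-disjoint vertex sets, called clusters, and replacing each edge of $F$ with the complete bipartite graph whose parts are the two corresponding clusters. A subgraph of $G$ is vertex-spanning if its vertex set is $V(G)$. The length of the cycle is not prescribed. *)

theory Defs
  imports Complex_Main "HOL-Library.Disjoint_Sets" "Graph_Theory.Graph_Theory"
begin

text \<open>
  Finite simple graphs are the \<^locale>\<open>pair_graph\<close>s of the library: an undirected edge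
  \<open>uv\<close> is the pair of arcs \<open>(u, v)\<close> and \<open>(v, u)\<close>. The degree of a vertex is therefore
  its out-degree.
\<close>

definition min_degree :: "'a pair_pre_digraph \<Rightarrow> nat" where
  "min_degree G = Min (out_degree (with_proj G) ` pverts G)"

text \<open>A cycle graph only for \<open>k \<ge> 3\<close>: there is a loop for \<open>k = 1\<close> and a single edge for \<open>k = 2\<close>.\<close>

definition cycle_graph :: "nat \<Rightarrow> nat pair_pre_digraph" where
  "cycle_graph k = \<lparr> pverts = {..<k},
     parcs = {(i, j). i < k \<and> j < k \<and> (j = Suc i mod k \<or> i = Suc j mod k)} \<rparr>"

text \<open>
  \<open>H\<close> is the complete blow-up of \<open>F\<close> with clusters \<open>C v\<close>, for \<open>v\<close> a vertex of \<open>F\<close>.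
  Clusters are required to be nonempty.
\<close>

definition is_blow_up :: "'b pair_pre_digraph \<Rightarrow> ('b \<Rightarrow> 'a set) \<Rightarrow> 'a pair_pre_digraph \<Rightarrow> bool" where
  "is_blow_up F C H \<longleftrightarrow>
     disjoint_family_on C (pverts F) \<and> (\<forall>v\<in>pverts F. C v \<noteq> {}) \<and>
     pverts H = (\<Union>v\<in>pverts F. C v) \<and>
     parcs H = (\<Union>(u, v)\<in>parcs F. C u \<times> C v)"

lemma pair_graph_cycle_graph:
  assumes "k \<ge> 3"
  shows "pair_graph (cycle_graph k)"
proof
  show "finite (parcs (cycle_graph k))"
    by (rule finite_subset[of _ "{..<k} \<times> {..<k}"]) (auto simp: cycle_graph_def)
  show "fst e \<noteq> snd e" if "e \<in> parcs (cycle_graph k)" for e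
    using that assms by (auto simp: cycle_graph_def mod_Suc split: if_splits)
qed (auto simp: cycle_graph_def symmetric_def sym_def)

lemma pair_graph_blow_up:
  assumes F: "pair_graph F" and H: "is_blow_up F C H"
    and fin: "\<And>v. v \<in> pverts F \<Longrightarrow> finite (C v)"
  shows "pair_graph H"
proof -
  interpret F: pair_graph F by (fact F)
  have sym: "(v, u) \<in> parcs F" if "(u, v) \<in> parcs F" for u v
    using that F.pair_sym_arcs by (auto simp: symmetric_def sym_def)
  show ?thesis
  proof
    show "fst e \<in> pverts H" "snd e \<in> pverts H" if "e \<in> parcs H" for e
      using that H by (auto simp: is_blow_up_def dest: F.in_arcsD1 F.in_arcsD2)
    show "finite (pverts H)"
      using H fin F.pair_finite_verts by (auto simp: is_blow_up_def)
    show "finite (parcs H)"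
      using H fin F.pair_finite_arcs
      by (auto simp: is_blow_up_def dest: F.in_arcsD1 F.in_arcsD2)
    show "fst e \<noteq> snd e" if "e \<in> parcs H" for e
    proof -
      from that H obtain u v where uv: "(u, v) \<in> parcs F" "fst e \<in> C u" "snd e \<in> C v"
        by (auto simp: is_blow_up_def)
      have "C u \<inter> C v = {}"
        using H uv(1) F.no_loops'[OF uv(1)] F.in_arcsD1[OF uv(1)] F.in_arcsD2[OF uv(1)]
        by (auto simp: is_blow_up_def disjoint_family_on_def)
      with uv show ?thesis by auto
    qed
    show "symmetric (with_proj H)"
    proof -
      have "(b, a) \<in> parcs H" if "(a, b) \<in> parcs H" for a b
      proof -
        from that H obtain u v where "(u, v) \<in> parcs F" "a \<in> C u" "b \<in> C v"
          by (auto simp: is_blow_up_def)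
        then have "(v, u) \<in> parcs F" "(b, a) \<in> C v \<times> C u"
          using sym by auto
        with H show ?thesis by (fastforce simp: is_blow_up_def)
      qed
      then show ?thesis by (auto simp: symmetric_def sym_def)
    qed
  qed
qed

end

theory Submission
  imports Defs
begin

text \<open>
  Write \<open>V\<close> for the vertex set, \<open>E\<close> for the symmetric arc relation and \<open>n\<close> for the number of
  vertices. Everything rests on one pigeonhole argument, \<open>popular_common_neighbourhood\<close>. Let
  \<open>P\<close> and \<open>Q\<close> be sets of \<open>p\<close> vertices and let \<open>W\<close> be a set whose vertices have on average at
  least \<open>(1 + 2 \<delta>) p\<close> neighbours in \<open>P\<close> and \<open>Q\<close> together. Then many vertices of \<open>W\<close> see a
  proportion \<open>\<delta>\<close> of both sets. If \<open>p\<close> is a small multiple of \<open>ln n\<close>, then the number of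
  possible traces of a neighbourhood on \<open>P \<union> Q\<close>, at most \<open>4\<^sup>p\<close>, is much smaller than
  \<open>card W\<close>, so many vertices of \<open>W\<close> have the same trace: constant proportions \<open>P' \<subseteq> P\<close> and
  \<open>Q' \<subseteq> Q\<close> are complete to one large set \<open>Z \<subseteq> W\<close>. As all degrees exceed \<open>n / 2\<close> by a
  linear amount, this applies to any two sets \<open>P\<close>, \<open>Q\<close> and any \<open>W\<close> that misses few vertices
  (\<open>connect\<close>). Neither randomness nor regularity is involved. There are three applications.

  Tiling (\<open>almost_perfect_tiling\<close>): disjoint complete pairs \<open>(A, B)\<close> with
  \<open>card A = card B = M\<close>, where \<open>M\<close> is of order \<open>ln n\<close>, cover all but \<open>\<gamma> n\<close> vertices. While
  the uncovered set \<open>U\<close> is larger, averaging yields a pair \<open>(P, Q)\<close> of the tiling, or two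
  disjoint subsets of \<open>U\<close>, to which \<open>U\<close> sends on average more than half of all edges. With
  \<open>W = U\<close> this gives \<open>P'\<close>, \<open>Q'\<close> and \<open>Z\<close>; matching \<open>P'\<close> and \<open>Q'\<close> with the two halves of
  \<open>Z\<close> instead of with each other covers more vertices, at the price of pairs that are smaller by
  a constant factor. One such level gains a fixed proportion of \<open>n\<close>, so boundedly many levels are
  enough.

  Absorption (\<open>perfect_pair_tiling\<close>): a chunk of uncovered vertices contains a set of size \<open>M\<close>
  that is complete to a large set \<open>Z\<close> of covered vertices. As \<open>Z\<close> is much larger than a cluster
  it meets many clusters, and a partner of size \<open>M\<close> can be taken from \<open>Z\<close> so that no cluster
  loses more than one vertex to it. The few vertices that do not fill a chunk are treated one at a time.
  This makes \<open>V\<close> a disjoint union of complete pairs whose sides all have nearly the same size.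

  Linking (\<open>cyclic_blow_up_of_pair_tiling\<close>): order the pairs \<open>(P\<^sub>i, Q\<^sub>i)\<close> cyclically. For each
  \<open>i\<close> there are small sets \<open>F\<^sub>i \<subseteq> Q\<^sub>i\<close> and \<open>X\<^sub>i \<subseteq> P\<^sub>i\<^sub>+\<^sub>1\<close> complete to a small set \<open>Z\<^sub>i\<close>, which is
  again spread over the clusters. What remains of \<open>P\<^sub>i\<close> and \<open>Q\<^sub>i\<close> is cut into equally many parts of
  nearly equal size, which are visited alternately before the cycle leaves through
  \<open>F\<^sub>i, Z\<^sub>i, X\<^sub>i\<close>. The sets removed are small compared with \<open>M\<close>, so the parts are as equal
  as desired.
\<close>

section \<open>Popular common neighbourhoods\<close>

lemma sum_card_neighbours_swap:
  assumes "finite W" "finite P" "sym E"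
  shows "(\<Sum>w\<in>W. card (P \<inter> E `` {w})) = (\<Sum>x\<in>P. card (W \<inter> E `` {x}))"
proof -
  have "(\<Sum>w\<in>W. card {x \<in> P. (w, x) \<in> E}) = (\<Sum>x\<in>P. card {w \<in> W. (w, x) \<in> E})"
    by (rule sum_multicount_gen) (use assms in auto)
  moreover have "{x \<in> P. (w, x) \<in> E} = P \<inter> E `` {w}" for w by auto
  moreover have "{w \<in> W. (w, x) \<in> E} = W \<inter> E `` {x}" for x
    using \<open>sym E\<close> by (auto dest: symD)
  ultimately show ?thesis by simp
qed

text \<open>
  A vertex of \<open>W\<close> that sees less than a proportion \<open>\<delta>\<close> of \<open>P\<close> or of \<open>Q\<close> contributes less than
  \<open>(1 + \<delta>) p\<close> to the sum, and every vertex contributes at most \<open>2 p\<close>. Hence a proportion of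
  at least \<open>\<delta>\<close> of \<open>W\<close> consists of vertices that see enough of both sets. These are then
  classified by their trace on \<open>P \<union> Q\<close>.
\<close>

lemma popular_common_neighbourhood:
  fixes \<delta> :: real
  assumes fin: "finite W" "finite P" "finite Q" and sym: "sym E"
    and p: "card P = p" "card Q = p" "p > 0" and \<delta>: "\<delta> > 0" and K: "K > 0"
    and sum: "(1 + 2 * \<delta>) * p * card W
      \<le> (\<Sum>w\<in>W. real (card (P \<inter> E `` {w}) + card (Q \<inter> E `` {w})))"
    and q: "q \<le> \<delta> * p" and large: "real K * 4 ^ p \<le> \<delta> / 2 * card W"
  obtains P' Q' Z where "P' \<subseteq> P" "Q' \<subseteq> Q" "Z \<subseteq> W" "card P' = q" "card Q' = q" "card Z = K"
    "P' \<times> Z \<subseteq> E" "Z \<times> Q' \<subseteq> E"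
proof -
  define good where "good = {w \<in> W. \<delta> * p \<le> card (P \<inter> E `` {w}) \<and> \<delta> * p \<le> card (Q \<inter> E `` {w})}"
  have good: "good \<subseteq> W" "finite good" using fin by (auto simp: good_def)
  have le_p: "card (P \<inter> E `` {w}) \<le> p" "card (Q \<inter> E `` {w}) \<le> p" for w
    using card_mono[OF fin(2), of "P \<inter> E `` {w}"] card_mono[OF fin(3), of "Q \<inter> E `` {w}"] p by auto
  have bound: "real (card (P \<inter> E `` {w}) + card (Q \<inter> E `` {w}))
      \<le> (1 + \<delta>) * p + (if w \<in> good then real p else 0)" if "w \<in> W" for w
  proof (cases "w \<in> good")
    case True
    have "real (card (P \<inter> E `` {w})) \<le> p" "real (card (Q \<inter> E `` {w})) \<le> p"
      using le_p by simp_all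
    moreover have "0 \<le> \<delta> * p" using \<delta> by simp
    ultimately show ?thesis using True by (simp add: algebra_simps)
  next
    case False
    then have "real (card (P \<inter> E `` {w})) < \<delta> * p \<or> real (card (Q \<inter> E `` {w})) < \<delta> * p"
      using that by (auto simp: good_def)
    moreover have "real (card (P \<inter> E `` {w})) \<le> p" "real (card (Q \<inter> E `` {w})) \<le> p"
      using le_p by simp_all
    ultimately show ?thesis using False by (auto simp: algebra_simps)
  qed
  have "(1 + 2 * \<delta>) * p * card W \<le> (\<Sum>w\<in>W. (1 + \<delta>) * p + (if w \<in> good then real p else 0))"
    using sum sum_mono[of W, OF bound] by (meson order_trans)
  also have "\<dots> = (1 + \<delta>) * p * card W + p * card good"
  proof -
    have "(\<Sum>w\<in>W. if w \<in> good then real p else 0) = (\<Sum>w\<in>W \<inter> good. real p)"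
      using sum.inter_restrict[OF fin(1), of "\<lambda>_. real p" good] by simp
    also have "W \<inter> good = good" using good by auto
    finally show ?thesis by (simp add: sum.distrib algebra_simps)
  qed
  finally have "p * (\<delta> * card W) \<le> p * real (card good)" by (simp add: algebra_simps)
  then have "\<delta> * card W \<le> card good" using p by simp
  moreover have "0 \<le> \<delta> * card W" using \<delta> by simp
  ultimately have cg: "real K * 4 ^ p \<le> card good" using large by linarith
  have cPow: "card (Pow (P \<union> Q)) \<le> 4 ^ p"
  proof -
    have "card (P \<union> Q) \<le> 2 * p" using card_Un_le[of P Q] p by simp
    then have "(2::nat) ^ card (P \<union> Q) \<le> 2 ^ (2 * p)" by (rule power_increasing) simp
    then show ?thesis using fin by (simp add: card_Pow power_mult)
  qed
  obtain T where T: "T \<in> Pow (P \<union> Q)"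
    "card ((\<lambda>w. (P \<union> Q) \<inter> E `` {w}) -` {T} \<inter> good) * card (Pow (P \<union> Q)) \<ge> card good"
    using pigeonhole_card[of "\<lambda>w. (P \<union> Q) \<inter> E `` {w}" good "Pow (P \<union> Q)"] good fin
    by auto
  define S where "S = (\<lambda>w. (P \<union> Q) \<inter> E `` {w}) -` {T} \<inter> good"
  have "real K * 4 ^ p \<le> real (card S * card (Pow (P \<union> Q)))"
    using cg T(2) unfolding S_def by linarith
  also have "\<dots> \<le> real (card S * 4 ^ p)"
    using cPow by (simp only: of_nat_le_iff mult_le_mono2)
  finally have "real K * 4 ^ p \<le> real (card S) * 4 ^ p" by simp
  then have "K \<le> card S" by simp
  then obtain Z where Z: "Z \<subseteq> S" "card Z = K" using obtain_subset_with_card_n by metis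
  then obtain z where z: "z \<in> S" using K by fastforce
  have zT: "P \<inter> T = P \<inter> E `` {z}" "Q \<inter> T = Q \<inter> E `` {z}" using z by (auto simp: S_def)
  \<comment> \<open>\<open>T\<close> is the trace of a vertex \<open>z\<close> that sees enough of \<open>P\<close> and \<open>Q\<close>.\<close>
  have "real q \<le> card (P \<inter> T)" "real q \<le> card (Q \<inter> T)"
    using q z zT by (auto simp: S_def good_def)
  then obtain P' Q' where PQ: "P' \<subseteq> P \<inter> T" "card P' = q" "Q' \<subseteq> Q \<inter> T" "card Q' = q"
    using obtain_subset_with_card_n of_nat_le_iff by metis
  show ?thesis
  proof
    show "P' \<times> Z \<subseteq> E"
    proof clarify
      fix x w assume "x \<in> P'" "w \<in> Z"
      then have "(w, x) \<in> E" using PQ Z by (auto simp: S_def)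
      then show "(x, w) \<in> E" using sym by (auto dest: symD)
    qed
    show "Z \<times> Q' \<subseteq> E" using PQ Z by (auto simp: S_def)
  qed (use PQ Z good in \<open>auto simp: S_def\<close>)
qed

locale dense_graph =
  fixes V :: "'a set" and E :: "'a rel" and \<epsilon> :: real
  assumes finite_V: "finite V" and V_nonempty: "V \<noteq> {}" and \<epsilon>_pos: "\<epsilon> > 0"
    and E_subset: "E \<subseteq> V \<times> V" and sym_E: "sym E" and irrefl_E: "irrefl E"
    and degree: "v \<in> V \<Longrightarrow> (1 / 2 + \<epsilon>) * card V \<le> card (E `` {v})"
begin

lemma card_V_pos: "card V > 0"
  using finite_V V_nonempty by (simp add: card_gt_0_iff)

lemma \<epsilon>_le: "\<epsilon> \<le> 1 / 2"
proof -
  obtain v where "v \<in> V" using V_nonempty by auto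
  have "card (E `` {v}) \<le> card V"
    by (rule card_mono) (use finite_V E_subset in auto)
  then have "(1 / 2 + \<epsilon>) * card V \<le> 1 * real (card V)"
    using degree[OF \<open>v \<in> V\<close>] by linarith
  then show ?thesis using card_V_pos by (subst (asm) mult_le_cancel_right) auto
qed

lemma four_le_ratio:
  fixes r :: nat
  assumes "2 \<le> \<epsilon> * r"
  shows "r \<ge> 4"
proof -
  have "\<epsilon> * r \<le> 1 / 2 * r" by (rule mult_right_mono) (use \<epsilon>_le in auto)
  then have "4 \<le> real r" using assms by linarith
  then show ?thesis by linarith
qed

lemma degree_into:
  assumes "v \<in> V" "W \<subseteq> V" "real (card (V - W)) \<le> b"
  shows "(1 / 2 + \<epsilon>) * card V - b \<le> card (W \<inter> E `` {v})"
proof -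
  have "card (E `` {v}) \<le> card ((W \<inter> E `` {v}) \<union> (V - W))"
    by (rule card_mono) (use finite_V E_subset finite_subset[OF assms(2)] in auto)
  also have "\<dots> \<le> card (W \<inter> E `` {v}) + card (V - W)" by (rule card_Un_le)
  finally show ?thesis using degree[OF assms(1)] assms(3) by linarith
qed

text \<open>
  \<open>P\<close> and \<open>Q\<close> may overlap; \<open>P = Q\<close> is used to find a large common neighbourhood of a
  proportion of a single set.
\<close>

lemma connect:
  assumes W: "W \<subseteq> V" "real (card (V - W)) \<le> \<epsilon> / 2 * card V"
    and P: "P \<subseteq> V" "card P = p" and Q: "Q \<subseteq> V" "card Q = p" and "p > 0" "K > 0"
    and q: "2 * real q \<le> \<epsilon> * p" and large: "real K * 4 ^ p \<le> \<epsilon> / 8 * card V"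
  obtains P' Q' Z where "P' \<subseteq> P" "Q' \<subseteq> Q" "Z \<subseteq> W" "card P' = q" "card Q' = q" "card Z = K"
    "P' \<times> Z \<subseteq> E" "Z \<times> Q' \<subseteq> E"
proof -
  have fin: "finite W" "finite P" "finite Q" using finite_V W P Q finite_subset by auto
  have into: "p * ((1 / 2 + \<epsilon> / 2) * card V) \<le> (\<Sum>w\<in>W. real (card (S \<inter> E `` {w})))"
    if "S \<subseteq> V" "card S = p" for S
  proof -
    have "p * ((1 / 2 + \<epsilon> / 2) * card V) = (\<Sum>x\<in>S. (1 / 2 + \<epsilon> / 2) * card V)"
      using that by simp
    also have "\<dots> \<le> (\<Sum>x\<in>S. real (card (W \<inter> E `` {x})))"
    proof (rule sum_mono)
      fix x assume "x \<in> S"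
      then show "(1 / 2 + \<epsilon> / 2) * card V \<le> real (card (W \<inter> E `` {x}))"
        using degree_into[OF _ W, of x] that by (auto simp: algebra_simps)
    qed
    also have "\<dots> = (\<Sum>w\<in>W. real (card (S \<inter> E `` {w})))"
      using sum_card_neighbours_swap[OF fin(1) _ sym_E, of S] that finite_V finite_subset
      by (metis of_nat_sum)
    finally show ?thesis .
  qed
  have cW: "real (card W) \<le> card V" using card_mono[OF finite_V W(1)] by simp
  have "card (V - W) = card V - card W"
    using W(1) fin by (simp add: card_Diff_subset)
  then have half: "card V / 2 \<le> card W"
  proof -
    have "\<epsilon> / 2 * card V \<le> 1 / 2 * real (card V)"
      by (rule mult_right_mono) (use \<epsilon>_le in auto)
    then show ?thesis using W(2) cW \<open>card (V - W) = card V - card W\<close> by linarith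
  qed
  have "(1 + 2 * (\<epsilon> / 2)) * p * card W \<le> (1 + 2 * (\<epsilon> / 2)) * p * card V"
    by (rule mult_left_mono) (use cW \<epsilon>_pos in auto)
  also have "\<dots> = p * ((1 / 2 + \<epsilon> / 2) * card V) + p * ((1 / 2 + \<epsilon> / 2) * card V)"
    by (simp add: algebra_simps)
  also have "\<dots> \<le> (\<Sum>w\<in>W. real (card (P \<inter> E `` {w}) + card (Q \<inter> E `` {w})))"
    unfolding of_nat_add sum.distrib by (rule add_mono) (rule into[OF P], rule into[OF Q])
  finally have sum: "(1 + 2 * (\<epsilon> / 2)) * p * card W
    \<le> (\<Sum>w\<in>W. real (card (P \<inter> E `` {w}) + card (Q \<inter> E `` {w})))" .
  have "\<epsilon> / 8 * card V \<le> \<epsilon> / 2 / 2 * card W"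
    using mult_left_mono[OF half, of "\<epsilon> / 4"] \<epsilon>_pos by simp
  with large have large': "real K * 4 ^ p \<le> \<epsilon> / 2 / 2 * card W" by linarith
  have q': "real q \<le> \<epsilon> / 2 * p" using q by simp
  show ?thesis
    by (rule popular_common_neighbourhood[OF fin sym_E P(2) Q(2) \<open>p > 0\<close> _ \<open>K > 0\<close> sum q' large'])
      (use \<epsilon>_pos that in auto)
qed

end

section \<open>Families of complete pairs\<close>

text \<open>
  The relation \<open>E\<close> is arbitrary because \<open>E = - Id\<close> is also needed: it gives pairs of sets that are
  merely disjoint, with no condition on edges between them. For irreflexive \<open>E\<close> the two sides of a
  pair are disjoint.
\<close>

definition bitiling :: "'a rel \<Rightarrow> nat \<Rightarrow> nat \<Rightarrow> ('a set \<times> 'a set) set \<Rightarrow> bool" where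
  "bitiling E lo hi \<P> \<longleftrightarrow> finite \<P> \<and> disjoint_family_on (\<lambda>(A, B). A \<union> B) \<P> \<and>
     (\<forall>(A, B)\<in>\<P>. A \<times> B \<subseteq> E \<and> finite A \<and> finite B \<and>
        card A \<in> {lo..hi} \<and> card B \<in> {lo..hi})"

definition covered :: "('a set \<times> 'a set) set \<Rightarrow> 'a set" where
  "covered \<P> = (\<Union>(A, B)\<in>\<P>. A \<union> B)"

lemma covered_simps [simp]:
  "covered {} = {}" "covered (insert (A, B) \<P>) = A \<union> B \<union> covered \<P>"
  "covered (\<P> \<union> \<Q>) = covered \<P> \<union> covered \<Q>"
  by (auto simp: covered_def)

lemma bitiling_empty [simp]: "bitiling E lo hi {}"
  by (simp add: bitiling_def disjoint_family_on_def)

lemma bitiling_mono: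
  "bitiling E lo hi \<P> \<Longrightarrow> E \<subseteq> E' \<Longrightarrow> lo' \<le> lo \<Longrightarrow> hi \<le> hi' \<Longrightarrow> bitiling E' lo' hi' \<P>"
  unfolding bitiling_def by fastforce

lemma bitiling_subset: "bitiling E lo hi \<P> \<Longrightarrow> \<Q> \<subseteq> \<P> \<Longrightarrow> bitiling E lo hi \<Q>"
  unfolding bitiling_def
  by (intro conjI) (simp add: finite_subset, simp add: disjoint_family_on_mono, meson subsetD)

lemma bitiling_Un:
  assumes "bitiling E lo hi \<P>" "bitiling E lo hi \<Q>" "covered \<P> \<inter> covered \<Q> = {}"
  shows "bitiling E lo hi (\<P> \<union> \<Q>)"
proof -
  have "disjoint_family_on (\<lambda>(A, B). A \<union> B) (\<P> \<union> \<Q>)"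
    unfolding disjoint_family_on_def
  proof (intro ballI impI)
    fix X Y assume XY: "X \<in> \<P> \<union> \<Q>" "Y \<in> \<P> \<union> \<Q>" "X \<noteq> Y"
    have sub: "(\<lambda>(A, B). A \<union> B) X \<subseteq> covered \<R>" if "X \<in> \<R>" for X :: "'a set \<times> 'a set" and \<R>
      using that by (auto simp: covered_def)
    have same: "(\<lambda>(A, B). A \<union> B) X \<inter> (\<lambda>(A, B). A \<union> B) Y = {}" if "X \<in> \<R>" "Y \<in> \<R>"
      "bitiling E lo hi \<R>" for \<R>
      using that XY(3) disjoint_family_onD[of "\<lambda>(A, B). A \<union> B" \<R> X Y] by (simp add: bitiling_def)
    show "(\<lambda>(A, B). A \<union> B) X \<inter> (\<lambda>(A, B). A \<union> B) Y = {}"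
    proof (cases "X \<in> \<P> \<longleftrightarrow> Y \<in> \<P>")
      case True
      then show ?thesis using XY(1,2) same[OF _ _ assms(1)] same[OF _ _ assms(2)] by blast
    next
      case False
      then have "X \<in> \<P> \<and> Y \<in> \<Q> \<or> X \<in> \<Q> \<and> Y \<in> \<P>" using XY(1,2) by auto
      then have "(\<lambda>(A, B). A \<union> B) X \<subseteq> covered \<P> \<and> (\<lambda>(A, B). A \<union> B) Y \<subseteq> covered \<Q> \<or>
          (\<lambda>(A, B). A \<union> B) X \<subseteq> covered \<Q> \<and> (\<lambda>(A, B). A \<union> B) Y \<subseteq> covered \<P>"
        using sub by blast
      then show ?thesis using assms(3) by blast
    qed
  qed
  then show ?thesis using assms unfolding bitiling_def by auto
qed

lemma bitiling_pair:
  "A \<times> B \<subseteq> E \<Longrightarrow> finite A \<Longrightarrow> finite B \<Longrightarrow> card A \<in> {lo..hi} \<Longrightarrow> card B \<in> {lo..hi}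
    \<Longrightarrow> bitiling E lo hi {(A, B)}"
  by (simp add: bitiling_def disjoint_family_on_def)

lemma bitiling_insert:
  assumes "bitiling E lo hi \<P>" "(A \<union> B) \<inter> covered \<P> = {}" "A \<times> B \<subseteq> E" "finite A" "finite B"
    "card A \<in> {lo..hi}" "card B \<in> {lo..hi}"
  shows "bitiling E lo hi (insert (A, B) \<P>)"
  using bitiling_Un[OF bitiling_pair[OF assms(3-7)] assms(1)] assms(2) by simp

lemma bitilingD:
  assumes "bitiling E lo hi \<P>" "(A, B) \<in> \<P>"
  shows "A \<times> B \<subseteq> E" "finite A" "finite B" "card A \<in> {lo..hi}" "card B \<in> {lo..hi}"
    "A \<union> B \<subseteq> covered \<P>"
  using assms by (fastforce simp: bitiling_def covered_def)+

lemma bitiling_finite: "bitiling E lo hi \<P> \<Longrightarrow> finite \<P>"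
  by (simp add: bitiling_def)

lemma finite_covered: "bitiling E lo hi \<P> \<Longrightarrow> finite (covered \<P>)"
  by (auto simp: bitiling_def covered_def)

lemma covered_remove:
  assumes "bitiling E lo hi \<P>" "(A, B) \<in> \<P>"
  shows "covered (\<P> - {(A, B)}) = covered \<P> - (A \<union> B)"
proof -
  have "(A \<union> B) \<inter> (A' \<union> B') = {}" if "(A', B') \<in> \<P>" "(A', B') \<noteq> (A, B)" for A' B'
    using assms that disjoint_family_onD[of "\<lambda>(A, B). A \<union> B" \<P> "(A, B)" "(A', B')"]
    by (auto simp: bitiling_def)
  then show ?thesis unfolding covered_def by fast
qed

lemma irrefl_Times_disjoint: "irrefl E \<Longrightarrow> A \<times> B \<subseteq> E \<Longrightarrow> A \<inter> B = {}"
  by (auto simp: irrefl_def)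

lemma card_covered_eq_sum:
  assumes "bitiling E lo hi \<P>" "irrefl E"
  shows "card (covered \<P>) = (\<Sum>(A, B)\<in>\<P>. card A + card B)"
proof -
  have "card (covered \<P>) = (\<Sum>X\<in>\<P>. card ((\<lambda>(A, B). A \<union> B) X))"
    unfolding covered_def
    by (rule card_UN_disjoint') (use assms in \<open>auto simp: bitiling_def\<close>)
  also have "\<dots> = (\<Sum>(A, B)\<in>\<P>. card A + card B)"
  proof (rule sum.cong)
    fix X assume X: "X \<in> \<P>"
    obtain A B where [simp]: "X = (A, B)" by (cases X)
    have "A \<inter> B = {}" using bitilingD[OF assms(1)] X irrefl_Times_disjoint[OF assms(2)] by simp
    then show "card ((\<lambda>(A, B). A \<union> B) X) = (case X of (A, B) \<Rightarrow> card A + card B)"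
      using bitilingD[OF assms(1)] X by (simp add: card_Un_disjoint)
  qed simp
  finally show ?thesis .
qed

lemma card_covered:
  assumes "bitiling E M M \<P>" "irrefl E"
  shows "card (covered \<P>) = 2 * M * card \<P>"
proof -
  have "(\<Sum>(A, B)\<in>\<P>. card A + card B) = (\<Sum>X\<in>\<P>. 2 * M)"
    by (rule sum.cong) (use assms in \<open>auto simp: bitiling_def\<close>)
  then show ?thesis using card_covered_eq_sum[OF assms] by simp
qed

lemma split_pair:
  assumes "A \<times> B \<subseteq> E" "irrefl E" "card A = k * M" "card B = k * M" "finite A" "finite B"
  obtains \<P> where "bitiling E M M \<P>" "covered \<P> = A \<union> B"
proof -
  have "\<exists>\<P>. bitiling E M M \<P> \<and> covered \<P> = A \<union> B"
    using assms
  proof (induction k arbitrary: A B)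
    case 0
    then show ?case by (intro exI[of _ "{}"]) auto
  next
    case (Suc k)
    then have "M \<le> card A" "M \<le> card B" by auto
    then obtain A1 B1 where AB: "A1 \<subseteq> A" "B1 \<subseteq> B" "card A1 = M" "card B1 = M"
      by (meson obtain_subset_with_card_n)
    then have fin: "finite A1" "finite B1" using Suc.prems finite_subset by auto
    have "\<exists>\<P>. bitiling E M M \<P> \<and> covered \<P> = (A - A1) \<union> (B - B1)"
      by (rule Suc.IH) (use Suc.prems AB fin in \<open>auto simp: card_Diff_subset\<close>)
    then obtain \<P> where \<P>: "bitiling E M M \<P>" "covered \<P> = (A - A1) \<union> (B - B1)" by auto
    have "A \<inter> B = {}" using Suc.prems irrefl_Times_disjoint by blast
    then have "bitiling E M M (insert (A1, B1) \<P>)"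
      by (intro bitiling_insert) (use \<P> AB fin Suc.prems in auto)
    then show ?case using \<P> AB by (intro exI[of _ "insert (A1, B1) \<P>"]) auto
  qed
  then show ?thesis using that by blast
qed

lemma bitiling_refine:
  assumes "bitiling E (k * M) (k * M) \<P>" "irrefl E"
  obtains \<Q> where "bitiling E M M \<Q>" "covered \<Q> = covered \<P>"
proof -
  have "finite \<P>" using assms bitiling_finite by blast
  then have "\<exists>\<Q>. bitiling E M M \<Q> \<and> covered \<Q> = covered \<P>" using assms(1)
  proof (induction \<P> rule: finite_induct)
    case empty
    then show ?case by (intro exI[of _ "{}"]) simp
  next
    case (insert X \<P>)
    obtain A B where X: "X = (A, B)" by (cases X)
    note t = insert.prems[unfolded X]
    have "bitiling E (k * M) (k * M) \<P>" by (rule bitiling_subset[OF t]) auto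
    then obtain \<Q> where \<Q>: "bitiling E M M \<Q>" "covered \<Q> = covered \<P>" using insert.IH by blast
    have "insert (A, B) \<P> - {(A, B)} = \<P>" using insert.hyps X by auto
    then have disj: "covered \<P> \<inter> (A \<union> B) = {}"
      using covered_remove[OF t, of A B] by auto
    obtain \<R> where \<R>: "bitiling E M M \<R>" "covered \<R> = A \<union> B"
      using split_pair[of A B E k M] bitilingD[OF t, of A B] assms(2) by auto
    have "bitiling E M M (\<Q> \<union> \<R>)" by (rule bitiling_Un) (use \<Q> \<R> disj in auto)
    then show ?case using \<Q> \<R> X by (intro exI[of _ "\<Q> \<union> \<R>"]) auto
  qed
  then show ?thesis using that by blast
qed

text \<open>
  These pairs inside the uncovered set take part in the averaging of \<open>augment_tiling\<close> on the same
  footing as the pairs of the tiling.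
\<close>

lemma obtain_pairing:
  fixes U :: "'a set"
  assumes "finite U" "p > 0"
  obtains \<F> where "bitiling (- Id) p p \<F>" "covered \<F> \<subseteq> U" "card (U - covered \<F>) < 2 * p"
proof -
  have "\<exists>\<F>. bitiling (- Id) p p \<F> \<and> covered \<F> \<subseteq> U \<and> card (U - covered \<F>) < 2 * p"
    using assms(1)
  proof (induction "card U" arbitrary: U rule: less_induct)
    case less
    show ?case
    proof (cases "card U < 2 * p")
      case True
      then show ?thesis by (intro exI[of _ "{}"]) simp
    next
      case False
      then obtain A where A: "A \<subseteq> U" "card A = p"
        using obtain_subset_with_card_n[of p U] by (metis le_add1 le_trans mult_2 not_le nat_le_linear)
      have finA: "finite A" using A less.prems finite_subset by auto
      then have "card (U - A) = card U - p" using A by (simp add: card_Diff_subset)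
      then obtain B where B: "B \<subseteq> U - A" "card B = p"
        using False obtain_subset_with_card_n[of p "U - A"] by (metis add_le_imp_le_diff mult_2 not_le)
      have finB: "finite B" using B less.prems finite_subset by auto
      have "A \<noteq> {}" using A assms(2) by auto
      then have "card (U - (A \<union> B)) < card U"
        by (intro psubset_card_mono) (use A B less.prems assms(2) in auto)
      with less obtain \<F> where \<F>: "bitiling (- Id) p p \<F>" "covered \<F> \<subseteq> U - (A \<union> B)"
        "card (U - (A \<union> B) - covered \<F>) < 2 * p"
        by (metis finite_Diff)
      have "bitiling (- Id) p p (insert (A, B) \<F>)"
        by (rule bitiling_insert) (use \<F> A B finA finB in auto)
      moreover have "U - covered (insert (A, B) \<F>) = U - (A \<union> B) - covered \<F>" by auto
      ultimately show ?thesis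
        using \<F> A B by (intro exI[of _ "insert (A, B) \<F>"]) auto
    qed
  qed
  then show ?thesis using that by blast
qed

section \<open>Tiling almost all vertices by complete pairs\<close>

context dense_graph begin

text \<open>
  \<open>\<T>\<close> consists of the pairs of the current level that are still intact, \<open>\<N>\<close> of the smaller
  pairs already produced. Let \<open>U\<close> be the uncovered set. All but \<open>\<epsilon> n / 2\<close> vertices lie in \<open>\<T>\<close>
  or in a pair chosen arbitrarily inside \<open>U\<close>, so the vertices of \<open>U\<close> still send more than half of
  their possible edges to the union of these pairs, and one pair \<open>(P, Q)\<close> achieves the average. From
  the sets \<open>P'\<close>, \<open>Q'\<close>, \<open>Z = Z\<^sub>1 \<union> Z\<^sub>2\<close> that it yields one obtains the new pairs \<open>(P', Z\<^sub>1)\<close> and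
  \<open>(Z\<^sub>2, Q')\<close>. If \<open>(P, Q)\<close> belongs to \<open>\<T>\<close>, the rest of \<open>P\<close> and \<open>Q\<close> splits into pairs of
  size \<open>M\<close>, because \<open>p\<close> is a multiple of \<open>M\<close>, and exactly \<open>Z\<close> is newly covered.
\<close>

lemma augment_tiling:
  assumes \<T>: "bitiling E p p \<T>" and \<N>: "bitiling E M M \<N>"
    and disj: "covered \<T> \<inter> covered \<N> = {}" and sub: "covered \<T> \<union> covered \<N> \<subseteq> V"
    and p: "p = r * M" "M > 0" and r: "2 \<le> \<epsilon> * r"
    and touched: "real (card (covered \<N>) + 2 * p) \<le> \<epsilon> / 2 * card V"
    and large: "real (2 * M) * 4 ^ p \<le> \<epsilon> / 4 * card (V - (covered \<T> \<union> covered \<N>))"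
  obtains \<T>' \<N>' where "bitiling E p p \<T>'" "bitiling E M M \<N>'"
    "covered \<T>' \<inter> covered \<N>' = {}" "covered \<T>' \<union> covered \<N>' \<subseteq> V"
    "card (covered \<N>') \<le> card (covered \<N>) + 2 * p + 2 * M"
    "card (covered \<T> \<union> covered \<N>) + 2 * M \<le> card (covered \<T>' \<union> covered \<N>')"
proof -
  define U where "U = V - (covered \<T> \<union> covered \<N>)"
  have finU: "finite U" "U \<subseteq> V" using finite_V by (auto simp: U_def)
  have r4: "r \<ge> 4" by (rule four_le_ratio[OF r])
  have p0: "p > 0" and Mp: "M \<le> p" using p r4 by auto
  obtain \<F> where \<F>: "bitiling (- Id) p p \<F>" "covered \<F> \<subseteq> U" "card (U - covered \<F>) < 2 * p"
    using obtain_pairing[OF finU(1) p0] by blast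
  have "E \<subseteq> - Id" using irrefl_E by (auto simp: irrefl_def)
  then have "bitiling (- Id) p p \<T>" using bitiling_mono[OF \<T>] by simp
  then have TF: "bitiling (- Id) p p (\<T> \<union> \<F>)"
    by (rule bitiling_Un) (use \<F> in \<open>auto simp: U_def\<close>)
  define W where "W = covered (\<T> \<union> \<F>)"
  have W: "W \<subseteq> V" using sub \<F> by (auto simp: W_def U_def)
  have irrId: "irrefl (- Id)" by (auto simp: irrefl_def)
  have cW: "card W = 2 * p * card (\<T> \<union> \<F>)"
    unfolding W_def by (rule card_covered[OF TF irrId])
  have VW: "real (card (V - W)) \<le> \<epsilon> / 2 * card V"
  proof -
    have "card (V - W) \<le> card (covered \<N> \<union> (U - covered \<F>))"
      by (rule card_mono) (use finite_covered[OF \<N>] finU in \<open>auto simp: W_def U_def\<close>)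
    also have "\<dots> \<le> card (covered \<N>) + card (U - covered \<F>)" by (rule card_Un_le)
    finally have "card (V - W) \<le> card (covered \<N>) + 2 * p" using \<F>(3) by simp
    then show ?thesis using touched by linarith
  qed
  \<comment> \<open>The number of edges between a set and \<open>U\<close>, counted from \<open>U\<close>.\<close>
  define wt where "wt = (\<lambda>S. \<Sum>w\<in>U. real (card (S \<inter> E `` {w})))"
  have U0: "card U > 0"
  proof (rule ccontr)
    assume "\<not> 0 < card U"
    then have "real (2 * M) * 4 ^ p \<le> 0" using large by (simp add: U_def)
    moreover have "0 < real (2 * M) * 4 ^ p" using p(2) by simp
    ultimately show False by linarith
  qed
  have "\<exists>(P, Q)\<in>\<T> \<union> \<F>. (1 + \<epsilon>) * p * card U \<le> wt P + wt Q"
  proof (rule ccontr)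
    assume "\<not> ?thesis"
    \<comment> \<open>Otherwise every pair stays below the average density.\<close>
    then have bad: "wt P + wt Q < (1 + \<epsilon>) * p * card U" if "(P, Q) \<in> \<T> \<union> \<F>" for P Q
      using that by force
    have "card U * ((1 / 2 + \<epsilon> / 2) * card V) = (\<Sum>w\<in>U. (1 / 2 + \<epsilon> / 2) * card V)" by simp
    also have "\<dots> \<le> wt W" unfolding wt_def
    proof (rule sum_mono)
      fix w assume "w \<in> U"
      then show "(1 / 2 + \<epsilon> / 2) * card V \<le> card (W \<inter> E `` {w})"
        using degree_into[OF _ W VW, of w] finU by (auto simp: algebra_simps)
    qed
    also have "\<dots> \<le> (\<Sum>(P, Q)\<in>\<T> \<union> \<F>. wt P + wt Q)"
    proof -
      have "real (card (W \<inter> E `` {w}))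
          \<le> (\<Sum>(P, Q)\<in>\<T> \<union> \<F>. real (card (P \<inter> E `` {w})) + real (card (Q \<inter> E `` {w})))" for w
      proof -
        have "W \<inter> E `` {w} = (\<Union>(P, Q)\<in>\<T> \<union> \<F>. P \<inter> E `` {w} \<union> Q \<inter> E `` {w})"
          by (auto simp: W_def covered_def)
        then have "card (W \<inter> E `` {w})
            \<le> (\<Sum>X\<in>\<T> \<union> \<F>. card (case X of (P, Q) \<Rightarrow> P \<inter> E `` {w} \<union> Q \<inter> E `` {w}))"
          using card_UN_le[OF bitiling_finite[OF TF]] by simp
        also have "\<dots> \<le> (\<Sum>(P, Q)\<in>\<T> \<union> \<F>. card (P \<inter> E `` {w}) + card (Q \<inter> E `` {w}))"
          by (rule sum_mono) (auto intro: card_Un_le)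
        finally have "real (card (W \<inter> E `` {w})) \<le>
          real (\<Sum>(P, Q)\<in>\<T> \<union> \<F>. card (P \<inter> E `` {w}) + card (Q \<inter> E `` {w}))" by linarith
        then show ?thesis by (simp add: case_prod_unfold)
      qed
      then have "wt W \<le> (\<Sum>w\<in>U. \<Sum>(P, Q)\<in>\<T> \<union> \<F>.
          real (card (P \<inter> E `` {w})) + real (card (Q \<inter> E `` {w})))"
        unfolding wt_def by (rule sum_mono)
      also have "\<dots> = (\<Sum>(P, Q)\<in>\<T> \<union> \<F>. wt P + wt Q)"
        unfolding wt_def case_prod_unfold by (subst sum.swap) (simp add: sum.distrib)
      finally show ?thesis .
    qed
    finally have *: "card U * ((1 / 2 + \<epsilon> / 2) * card V) \<le> (\<Sum>(P, Q)\<in>\<T> \<union> \<F>. wt P + wt Q)" .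
    have ne: "\<T> \<union> \<F> \<noteq> {}"
    proof
      assume "\<T> \<union> \<F> = {}"
      then have "card U * ((1 / 2 + \<epsilon> / 2) * card V) \<le> 0" using * by simp
      moreover have "0 < card U * ((1 / 2 + \<epsilon> / 2) * card V)"
        using U0 card_V_pos \<epsilon>_pos by simp
      ultimately show False by linarith
    qed
    have "(\<Sum>(P, Q)\<in>\<T> \<union> \<F>. wt P + wt Q) < (\<Sum>X\<in>\<T> \<union> \<F>. (1 + \<epsilon>) * p * card U)"
      by (rule sum_strict_mono) (use bitiling_finite[OF TF] ne bad in auto)
    also have "\<dots> = card U * ((1 / 2 + \<epsilon> / 2) * card W)"
      by (simp add: cW algebra_simps)
    also have "\<dots> \<le> card U * ((1 / 2 + \<epsilon> / 2) * card V)"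
      by (intro mult_left_mono) (use card_mono[OF finite_V W] \<epsilon>_pos in auto)
    finally show False using * by linarith
  qed
  then obtain P Q where PQ: "(P, Q) \<in> \<T> \<union> \<F>" "(1 + \<epsilon>) * p * card U \<le> wt P + wt Q" by auto
  have PQ': "finite P" "finite Q" "card P = p" "card Q = p" "P \<inter> Q = {}"
    using bitilingD[OF TF PQ(1)] by auto
  have q: "real M \<le> \<epsilon> / 2 * p"
  proof -
    have "2 * real M \<le> \<epsilon> * r * M" by (rule mult_right_mono) (use r in auto)
    then show ?thesis by (simp add: p)
  qed
  have large': "real (2 * M) * 4 ^ p \<le> \<epsilon> / 2 / 2 * card U" using large by (simp add: U_def)
  have sum: "(1 + 2 * (\<epsilon> / 2)) * p * card U
      \<le> (\<Sum>w\<in>U. real (card (P \<inter> E `` {w}) + card (Q \<inter> E `` {w})))"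
    using PQ(2) by (simp add: wt_def sum.distrib)
  obtain P' Q' Z where Z: "P' \<subseteq> P" "Q' \<subseteq> Q" "Z \<subseteq> U" "card P' = M" "card Q' = M"
    "card Z = 2 * M" "P' \<times> Z \<subseteq> E" "Z \<times> Q' \<subseteq> E"
    using popular_common_neighbourhood[OF finU(1) PQ'(1,2) sym_E PQ'(3,4) p0 _ _ sum q large']
      \<epsilon>_pos p(2) by auto
  have "M \<le> card Z" using Z by simp
  then obtain Z1 where Z1: "Z1 \<subseteq> Z" "card Z1 = M" by (meson obtain_subset_with_card_n)
  define Z2 where "Z2 = Z - Z1"
  have finZ: "finite P'" "finite Q'" "finite Z1" "finite Z2" "finite Z"
    using Z Z1 PQ' finU finite_subset unfolding Z2_def by (metis finite_Diff)+
  have Z2: "card Z2 = M" using Z1 Z finZ by (simp add: Z2_def card_Diff_subset)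
  have ZZ: "Z1 \<inter> Z2 = {}" "Z1 \<union> Z2 = Z" using Z1 by (auto simp: Z2_def)
  have dZ: "P' \<inter> Z = {}" "Z \<inter> Q' = {}" using Z irrefl_Times_disjoint[OF irrefl_E] by auto
  define new where "new = {(P', Z1), (Z2, Q')}"
  have new: "bitiling E M M new" unfolding new_def
    by (intro bitiling_insert bitiling_pair)
      (use Z Z1 Z2 ZZ dZ finZ PQ' in \<open>auto simp: Z2_def\<close>)
  have cnew: "covered new = P' \<union> Q' \<union> Z" using ZZ by (auto simp: new_def)
  have UTN: "U \<inter> covered \<T> = {}" "U \<inter> covered \<N> = {}" by (auto simp: U_def)
  have finTN: "finite (covered \<T>)" "finite (covered \<N>)" using finite_covered \<T> \<N> by auto
  show ?thesis
  proof (cases "(P, Q) \<in> \<T>")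
    case True
    note D = bitilingD[OF \<T> True]
    have rM: "p = (r - 1) * M + M" using p r4 by (simp add: algebra_simps diff_mult_distrib)
    \<comment> \<open>Removing \<open>P'\<close> and \<open>Q'\<close> leaves a complete pair whose sides are multiples of \<open>M\<close>.\<close>
    obtain \<R> where \<R>: "bitiling E M M \<R>" "covered \<R> = (P - P') \<union> (Q - Q')"
    proof (rule split_pair[of "P - P'" "Q - Q'" E "r - 1" M])
      show "card (P - P') = (r - 1) * M" "card (Q - Q') = (r - 1) * M"
        using Z PQ' finZ rM by (simp_all add: card_Diff_subset)
    qed (use D PQ' irrefl_E in auto)
    have nR: "bitiling E M M (new \<union> \<R>)"
    proof (rule bitiling_Un[OF new \<R>(1)])
      show "covered new \<inter> covered \<R> = {}" unfolding cnew \<R>(2)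
        using Z(1-3) PQ'(5) D(6) UTN by blast
    qed
    have cR: "covered (new \<union> \<R>) = P \<union> Q \<union> Z" using cnew \<R> Z(1,2) by auto
    define \<T>' where "\<T>' = \<T> - {(P, Q)}"
    have T': "bitiling E p p \<T>'" using bitiling_subset[OF \<T>] by (auto simp: \<T>'_def)
    have cT': "covered \<T>' = covered \<T> - (P \<union> Q)"
      unfolding \<T>'_def by (rule covered_remove[OF \<T> True])
    have cov: "covered \<T>' \<union> covered (\<N> \<union> (new \<union> \<R>)) = (covered \<T> \<union> covered \<N>) \<union> Z"
      using cT' cR D(6) by auto
    show ?thesis
    proof (rule that[OF T'])
      show "bitiling E M M (\<N> \<union> (new \<union> \<R>))"
        by (rule bitiling_Un[OF \<N> nR]) (use cR D(6) UTN Z(3) disj in auto)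
      show "covered \<T>' \<inter> covered (\<N> \<union> (new \<union> \<R>)) = {}"
        using cT' cR D(6) disj Z(3) UTN by auto
      show "covered \<T>' \<union> covered (\<N> \<union> (new \<union> \<R>)) \<subseteq> V"
        unfolding cov using sub Z(3) finU by auto
      have "card (covered (\<N> \<union> (new \<union> \<R>))) \<le> card (covered \<N>) + card (P \<union> Q \<union> Z)"
        using card_Un_le[of "covered \<N>" "P \<union> Q \<union> Z"] cR by simp
      also have "card (P \<union> Q \<union> Z) \<le> 2 * p + 2 * M"
        using card_Un_le[of "P \<union> Q" Z] card_Un_le[of P Q] PQ' Z by simp
      finally show "card (covered (\<N> \<union> (new \<union> \<R>))) \<le> card (covered \<N>) + 2 * p + 2 * M" by simp
      have "card ((covered \<T> \<union> covered \<N>) \<union> Z) = card (covered \<T> \<union> covered \<N>) + card Z"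
        by (rule card_Un_disjoint) (use finTN finZ Z(3) UTN in auto)
      then show "card (covered \<T> \<union> covered \<N>) + 2 * M
        \<le> card (covered \<T>' \<union> covered (\<N> \<union> (new \<union> \<R>)))"
        unfolding cov using Z by simp
    qed
  next
    case False
    then have "(P, Q) \<in> \<F>" using PQ by auto
    then have PU: "P \<union> Q \<subseteq> U" using bitilingD(6)[OF \<F>(1)] \<F>(2) by blast
    have nU: "covered new \<subseteq> U" unfolding cnew using Z PU by auto
    have "card (covered new) = 4 * M"
    proof -
      have "(P', Z1) \<noteq> (Z2, Q')"
      proof
        assume "(P', Z1) = (Z2, Q')"
        then have "P' = {}" using dZ ZZ by auto
        then show False using Z p by simp
      qed
      then show ?thesis using card_covered[OF new irrefl_E] by (simp add: new_def)
    qed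
    show ?thesis
    proof (rule that[OF \<T>])
      show "bitiling E M M (\<N> \<union> new)"
        by (rule bitiling_Un[OF \<N> new]) (use nU UTN in auto)
      show "covered \<T> \<inter> covered (\<N> \<union> new) = {}" using disj nU UTN by auto
      show "covered \<T> \<union> covered (\<N> \<union> new) \<subseteq> V" using sub nU finU by auto
      show "card (covered (\<N> \<union> new)) \<le> card (covered \<N>) + 2 * p + 2 * M"
        using card_Un_le[of "covered \<N>" "covered new"] \<open>card (covered new) = 4 * M\<close> Mp by simp
      have "card ((covered \<T> \<union> covered \<N>) \<union> covered new)
          = card (covered \<T> \<union> covered \<N>) + card (covered new)"
        by (rule card_Un_disjoint) (use finTN finite_covered[OF new] nU UTN in auto)
      then show "card (covered \<T> \<union> covered \<N>) + 2 * M \<le> card (covered \<T> \<union> covered (\<N> \<union> new))"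
        using \<open>card (covered new) = 4 * M\<close> by (simp add: Un_assoc)
    qed
  qed
qed

end

lemma eight_times_le_power: "8 * n \<le> (8::nat) ^ n"
proof (cases n)
  case (Suc m)
  have "m < 2 ^ m" by (rule less_exp)
  also have "(2::nat) ^ m \<le> 8 ^ m" by (rule power_mono) simp_all
  finally show ?thesis using Suc by simp
qed simp

context dense_graph begin

text \<open>
  The number \<open>j\<close> of steps is limited only by the requirement that the pairs already touched, which
  no longer enter the averaging, occupy at most about \<open>\<epsilon> n / 2\<close> vertices.
\<close>

lemma augment_tiling_iterate:
  fixes \<gamma> :: real
  assumes \<T>: "bitiling E p p \<T>" "covered \<T> \<subseteq> V"
    and p: "p = r * M" "M > 0" and r: "2 \<le> \<epsilon> * r"
    and small: "real ((2 * p + 2 * M) * j + 2 * p) \<le> \<epsilon> / 2 * card V"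
    and large: "real (2 * M) * 4 ^ p \<le> \<epsilon> / 4 * (\<gamma> * card V)"
  obtains \<P> where "bitiling E M M \<P>" "covered \<P> \<subseteq> V"
    "(1 - \<gamma>) * card V \<le> card (covered \<P>) \<or> card (covered \<T>) + 2 * M * j \<le> card (covered \<P>)"
proof -
  have "\<exists>\<T>' \<N>. bitiling E p p \<T>' \<and> bitiling E M M \<N> \<and> covered \<T>' \<inter> covered \<N> = {} \<and>
      covered \<T>' \<union> covered \<N> \<subseteq> V \<and> card (covered \<N>) \<le> (2 * p + 2 * M) * j \<and>
      ((1 - \<gamma>) * card V \<le> card (covered \<T>' \<union> covered \<N>) \<or>
        card (covered \<T>) + 2 * M * j \<le> card (covered \<T>' \<union> covered \<N>))"
    using small
  proof (induction j)
    case 0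
    then show ?case using \<T> by (intro exI[of _ \<T>] exI[of _ "{}"]) simp
  next
    case (Suc j)
    have "real ((2 * p + 2 * M) * j + 2 * p) \<le> real ((2 * p + 2 * M) * Suc j + 2 * p)"
      by (simp only: of_nat_le_iff) simp
    then have "real ((2 * p + 2 * M) * j + 2 * p) \<le> \<epsilon> / 2 * card V" using Suc.prems by linarith
    from Suc.IH[OF this] obtain \<T>' \<N> where IH: "bitiling E p p \<T>'" "bitiling E M M \<N>"
      "covered \<T>' \<inter> covered \<N> = {}" "covered \<T>' \<union> covered \<N> \<subseteq> V"
      "card (covered \<N>) \<le> (2 * p + 2 * M) * j"
      "(1 - \<gamma>) * card V \<le> card (covered \<T>' \<union> covered \<N>) \<or>
        card (covered \<T>) + 2 * M * j \<le> card (covered \<T>' \<union> covered \<N>)"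
      by blast
    show ?case
    proof (cases "(1 - \<gamma>) * card V \<le> card (covered \<T>' \<union> covered \<N>)")
      case True
      have "card (covered \<N>) \<le> (2 * p + 2 * M) * Suc j" using IH(5) by simp
      then show ?thesis using True IH by (intro exI[of _ \<T>'] exI[of _ \<N>]) simp
    next
      case False
      have fin: "finite (covered \<T>' \<union> covered \<N>)" using IH finite_covered by blast
      have "real (card (V - (covered \<T>' \<union> covered \<N>)))
          = card V - real (card (covered \<T>' \<union> covered \<N>))"
        using card_Diff_subset[OF fin IH(4)] card_mono[OF finite_V IH(4)] by (simp add: of_nat_diff)
      then have "\<gamma> * card V \<le> card (V - (covered \<T>' \<union> covered \<N>))"
        using False by (simp add: algebra_simps)
      then have "\<epsilon> / 4 * (\<gamma> * card V) \<le> \<epsilon> / 4 * card (V - (covered \<T>' \<union> covered \<N>))"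
        by (rule mult_left_mono) (use \<epsilon>_pos in simp)
      then have l: "real (2 * M) * 4 ^ p \<le> \<epsilon> / 4 * card (V - (covered \<T>' \<union> covered \<N>))"
        using large by linarith
      have t: "real (card (covered \<N>) + 2 * p) \<le> \<epsilon> / 2 * card V"
        using IH(5) \<open>real ((2 * p + 2 * M) * j + 2 * p) \<le> \<epsilon> / 2 * card V\<close>
        by (smt (verit) of_nat_add of_nat_le_iff)
      obtain \<T>'' \<N>' where *: "bitiling E p p \<T>''" "bitiling E M M \<N>'"
        "covered \<T>'' \<inter> covered \<N>' = {}" "covered \<T>'' \<union> covered \<N>' \<subseteq> V"
        "card (covered \<N>') \<le> card (covered \<N>) + 2 * p + 2 * M"
        "card (covered \<T>' \<union> covered \<N>) + 2 * M \<le> card (covered \<T>'' \<union> covered \<N>')"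
        using augment_tiling[OF IH(1-4) p r t l] by metis
      have "card (covered \<N>') \<le> (2 * p + 2 * M) * Suc j" using IH(5) *(5) by simp
      moreover have "card (covered \<T>) + 2 * M * Suc j \<le> card (covered \<T>'' \<union> covered \<N>')"
        using IH(6) False *(6) by simp
      ultimately show ?thesis using * by blast
    qed
  qed
  then obtain \<T>' \<N> where TN: "bitiling E p p \<T>'" "bitiling E M M \<N>"
      "covered \<T>' \<inter> covered \<N> = {}" "covered \<T>' \<union> covered \<N> \<subseteq> V"
      "(1 - \<gamma>) * card V \<le> card (covered \<T>' \<union> covered \<N>) \<or>
        card (covered \<T>) + 2 * M * j \<le> card (covered \<T>' \<union> covered \<N>)"
    by blast
  obtain \<R> where \<R>: "bitiling E M M \<R>" "covered \<R> = covered \<T>'"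
    using bitiling_refine[of E r M \<T>'] TN(1) irrefl_E p by auto
  show ?thesis
  proof (rule that)
    show "bitiling E M M (\<R> \<union> \<N>)" by (rule bitiling_Un) (use \<R> TN in auto)
  qed (use \<R> TN in auto)
qed

text \<open>
  Induction on the number \<open>k\<close> of levels, the pair size being divided by \<open>r\<close> at each level. As one
  step touches at most \<open>2 (r + 1) M\<close> vertices and gains \<open>2 M\<close>, about \<open>\<epsilon> n / 2\<close> touched
  vertices yield a gain of at least \<open>\<epsilon> n / (4 (r + 1))\<close>.
\<close>

lemma tiling_by_levels:
  fixes \<gamma> :: real and r k :: nat
  assumes \<gamma>: "0 < \<gamma>" "\<gamma> \<le> 1 / 2" and r: "2 \<le> \<epsilon> * r"
    and M: "M > 0" and large: "8 ^ (r ^ k * M) \<le> \<epsilon> * \<gamma> / 4 * card V"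
  obtains \<P> where "bitiling E M M \<P>" "covered \<P> \<subseteq> V"
    "(1 - \<gamma>) * card V \<le> card (covered \<P>) \<or> k * (\<epsilon> / (4 * (r + 1))) * card V \<le> card (covered \<P>)"
proof -
  have r4: "r \<ge> 4" by (rule four_le_ratio[OF r])
  have "\<exists>\<P>. bitiling E M M \<P> \<and> covered \<P> \<subseteq> V \<and>
    ((1 - \<gamma>) * card V \<le> card (covered \<P>) \<or> k * (\<epsilon> / (4 * (r + 1))) * card V \<le> card (covered \<P>))"
    using M large
  proof (induction k arbitrary: M)
    case 0
    then show ?case by (intro exI[of _ "{}"]) simp
  next
    case (Suc k)
    define p where "p = r * M"
    have p0: "p > 0" using Suc.prems r4 by (simp add: p_def)
    have big: "8 ^ (r ^ k * p) \<le> \<epsilon> * \<gamma> / 4 * card V"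
      using Suc.prems by (simp add: p_def algebra_simps)
    obtain \<T> where \<T>: "bitiling E p p \<T>" "covered \<T> \<subseteq> V"
      "(1 - \<gamma>) * card V \<le> card (covered \<T>) \<or> k * (\<epsilon> / (4 * (r + 1))) * card V \<le> card (covered \<T>)"
      using Suc.IH[OF p0 big] by blast
    have "p \<le> r ^ k * p" using r4 by simp
    then have "(8::real) ^ p \<le> 8 ^ (r ^ k * p)" by (rule power_increasing) simp
    then have p8: "8 ^ p \<le> \<epsilon> * \<gamma> / 4 * card V" using big by linarith
    have "\<epsilon> * \<gamma> / 4 * card V \<le> \<epsilon> * (1 / 2) / 4 * card V"
      by (intro mult_right_mono divide_right_mono mult_left_mono) (use \<gamma> \<epsilon>_pos in auto)
    moreover have "8 * real p \<le> 8 ^ p"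
      using eight_times_le_power[of p] by (metis of_nat_le_iff of_nat_mult of_nat_numeral of_nat_power)
    ultimately have lin: "8 * real p \<le> \<epsilon> / 8 * card V" using p8 by simp
    have Mp: "4 * M \<le> p" using r4 by (simp add: p_def)
    have "2 * M \<le> 2 ^ p" using Mp less_exp[of p] by linarith
    then have "real (2 * M) \<le> 2 ^ p" by (metis of_nat_le_iff of_nat_numeral of_nat_power)
    then have "real (2 * M) * 4 ^ p \<le> 2 ^ p * 4 ^ p" by (rule mult_right_mono) simp
    also have "\<dots> = 8 ^ p" by (simp flip: power_mult_distrib)
    finally have l: "real (2 * M) * 4 ^ p \<le> \<epsilon> / 4 * (\<gamma> * card V)" using p8 by simp
    define c where "c = real (2 * M * (r + 1))"
    have c: "c > 0" "c = real (2 * p + 2 * M)"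
      unfolding c_def of_nat_0_less_iff p_def using Suc.prems(1) by (simp, simp add: algebra_simps)
    \<comment> \<open>The largest number of steps for which the touched part stays below \<open>\<epsilon> n / 2\<close>.\<close>
    define j where "j = nat \<lfloor>(\<epsilon> / 2 * card V - 2 * p) / c\<rfloor>"
    have nn: "(\<epsilon> / 2 * card V - 2 * p) / c \<ge> 0" using lin c by simp
    then have j: "real j \<le> (\<epsilon> / 2 * card V - 2 * p) / c" "(\<epsilon> / 2 * card V - 2 * p) / c < real j + 1"
      by (auto simp: j_def)
    have "real j * c \<le> \<epsilon> / 2 * card V - 2 * p" using j(1) c by (simp add: pos_le_divide_eq)
    then have s: "real ((2 * p + 2 * M) * j + 2 * p) \<le> \<epsilon> / 2 * card V"
      using c(2) by (simp add: algebra_simps)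
    have "\<epsilon> / 2 * card V - 2 * p < (real j + 1) * c" using j(2) c by (simp add: pos_divide_less_eq)
    then have "\<epsilon> / 2 * card V - 2 * p - c < real j * c" by (simp add: algebra_simps)
    moreover have "c + 2 * p \<le> \<epsilon> / 4 * card V" using c(2) Mp lin by simp
    ultimately have "\<epsilon> / 4 * card V \<le> (2 * M * real j) * (r + 1)"
      by (simp add: c_def algebra_simps)
    then have gain: "\<epsilon> / (4 * (r + 1)) * card V \<le> 2 * M * real j"
      by (simp add: field_simps)
    obtain \<P> where \<P>: "bitiling E M M \<P>" "covered \<P> \<subseteq> V"
      "(1 - \<gamma>) * card V \<le> card (covered \<P>) \<or> card (covered \<T>) + 2 * M * j \<le> card (covered \<P>)"
      using augment_tiling_iterate[OF \<T>(1,2) p_def Suc.prems(1) r s l] by blast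
    have "(1 - \<gamma>) * card V \<le> card (covered \<P>) \<or>
        Suc k * (\<epsilon> / (4 * (r + 1))) * card V \<le> card (covered \<P>)"
    proof (cases "(1 - \<gamma>) * card V \<le> card (covered \<P>)")
      case False
      then have *: "real (card (covered \<T>)) + 2 * M * real j \<le> card (covered \<P>)"
        using \<P>(3) by (metis (mono_tags, lifting) of_nat_add of_nat_le_iff of_nat_mult)
      have "0 \<le> 2 * M * real j" by simp
      then have "k * (\<epsilon> / (4 * (r + 1))) * card V \<le> card (covered \<T>)"
        using \<T>(3) False * by linarith
      then have "k * (\<epsilon> / (4 * (r + 1))) * card V + \<epsilon> / (4 * (r + 1)) * card V \<le> card (covered \<P>)"
        using * gain by linarith
      also have "k * (\<epsilon> / (4 * (r + 1))) * card V + \<epsilon> / (4 * (r + 1)) * card V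
          = Suc k * (\<epsilon> / (4 * (r + 1))) * card V"
        by (simp only: of_nat_Suc distrib_right mult_1 add.commute)
      finally show ?thesis by blast
    qed simp
    then show ?case using \<P> by blast
  qed
  then show ?thesis using that by blast
qed

lemma almost_perfect_tiling:
  fixes \<gamma> :: real and r k :: nat
  assumes \<gamma>: "0 < \<gamma>" "\<gamma> \<le> 1 / 2" and r: "2 \<le> \<epsilon> * r" and k: "4 * (r + 1) \<le> \<epsilon> * k"
    and M: "M > 0" and large: "8 ^ (r ^ k * M) \<le> \<epsilon> * \<gamma> / 4 * card V"
  obtains \<P> where "bitiling E M M \<P>" "covered \<P> \<subseteq> V" "(1 - \<gamma>) * card V \<le> card (covered \<P>)"
proof -
  obtain \<P> where \<P>: "bitiling E M M \<P>" "covered \<P> \<subseteq> V"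
    "(1 - \<gamma>) * card V \<le> card (covered \<P>) \<or> k * (\<epsilon> / (4 * (r + 1))) * card V \<le> card (covered \<P>)"
    using tiling_by_levels[OF \<gamma> r M large] by blast
  have "1 \<le> k * (\<epsilon> / (4 * (r + 1)))" using k by (simp add: field_simps)
  then have "1 * real (card V) \<le> k * (\<epsilon> / (4 * (r + 1))) * card V" by (rule mult_right_mono) simp
  moreover have "(1 - \<gamma>) * card V \<le> 1 * real (card V)" by (rule mult_right_mono) (use \<gamma> in auto)
  ultimately have "(1 - \<gamma>) * card V \<le> card (covered \<P>)" using \<P>(3) by linarith
  then show ?thesis using that \<P> by blast
qed

end

section \<open>Spreading the loss over the clusters\<close>

text \<open>
  \<open>\<C>\<close> is a family of disjoint clusters and \<open>D\<close> the set of vertices already in use; a cluster that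
  has lost \<open>s\<close> vertices is closed.
\<close>

definition available :: "'a set set \<Rightarrow> nat \<Rightarrow> 'a set \<Rightarrow> 'a set" where
  "available \<C> s D = \<Union>{C \<in> \<C>. card (C \<inter> D) < s} - D"

lemma available_subset: "available \<C> s D \<subseteq> \<Union>\<C> - D"
  by (auto simp: available_def)

lemma sum_card_Int_le:
  assumes "disjoint \<C>" "finite \<C>" "finite D"
  shows "(\<Sum>C\<in>\<C>. card (C \<inter> D)) = card (\<Union>\<C> \<inter> D)"
proof -
  have "card (\<Union>C\<in>\<C>. C \<inter> D) = (\<Sum>C\<in>\<C>. card (C \<inter> D))"
    by (rule card_UN_disjoint) (use assms in \<open>auto dest: disjointD\<close>)
  moreover have "(\<Union>C\<in>\<C>. C \<inter> D) = \<Union>\<C> \<inter> D" by auto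
  ultimately show ?thesis by simp
qed

text \<open>
  Every closed cluster contains at least \<open>s\<close> vertices of \<open>D\<close>, so closing wastes at most \<open>M / s\<close>
  vertices for each vertex in use.
\<close>

lemma card_unavailable:
  assumes \<C>: "disjoint \<C>" "finite \<C>" "\<And>C. C \<in> \<C> \<Longrightarrow> finite C \<and> card C \<le> M" and "finite D"
  shows "s * card (\<Union>\<C> - available \<C> s D) \<le> (s + M) * card (\<Union>\<C> \<inter> D)"
proof -
  define full where "full = {C \<in> \<C>. s \<le> card (C \<inter> D)}"
  have full: "full \<subseteq> \<C>" "finite full" using \<C>(2) by (auto simp: full_def)
  have "\<Union>\<C> - available \<C> s D \<subseteq> (\<Union>\<C> \<inter> D) \<union> \<Union>full"
  proof
    fix x assume x: "x \<in> \<Union>\<C> - available \<C> s D"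
    then obtain C where C: "C \<in> \<C>" "x \<in> C" by auto
    show "x \<in> (\<Union>\<C> \<inter> D) \<union> \<Union>full"
    proof (cases "card (C \<inter> D) < s")
      case True
      then have "x \<in> D" using x C by (auto simp: available_def)
      then show ?thesis using C by auto
    next
      case False
      then have "C \<in> full" using C by (simp add: full_def)
      then show ?thesis using C by auto
    qed
  qed
  then have "card (\<Union>\<C> - available \<C> s D) \<le> card ((\<Union>\<C> \<inter> D) \<union> \<Union>full)"
    by (rule card_mono[rotated]) (use \<C> full \<open>finite D\<close> in auto)
  also have "\<dots> \<le> card (\<Union>\<C> \<inter> D) + card (\<Union>full)" by (rule card_Un_le)
  also have "card (\<Union>full) \<le> (\<Sum>C\<in>full. card C)" by (rule card_Union_le_sum_card)
  also have "\<dots> \<le> (\<Sum>C\<in>full. M)" by (rule sum_mono) (use \<C> full in auto)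
  finally have 1: "card (\<Union>\<C> - available \<C> s D) \<le> card (\<Union>\<C> \<inter> D) + card full * M" by simp
  have "card full * s = (\<Sum>C\<in>full. s)" by simp
  also have "\<dots> \<le> (\<Sum>C\<in>full. card (C \<inter> D))" by (rule sum_mono) (auto simp: full_def)
  also have "\<dots> \<le> (\<Sum>C\<in>\<C>. card (C \<inter> D))" by (rule sum_mono2) (use \<C> full in auto)
  also have "\<dots> = card (\<Union>\<C> \<inter> D)" by (rule sum_card_Int_le) (use assms in auto)
  finally have "card full * s * M \<le> card (\<Union>\<C> \<inter> D) * M" by (rule mult_right_mono) simp
  note full_le = this
  have "s * card (\<Union>\<C> - available \<C> s D) \<le> s * (card (\<Union>\<C> \<inter> D) + card full * M)"
    using 1 by (rule mult_left_mono) simp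
  also have "\<dots> = s * card (\<Union>\<C> \<inter> D) + card full * s * M" by (simp add: algebra_simps)
  also have "\<dots> \<le> s * card (\<Union>\<C> \<inter> D) + card (\<Union>\<C> \<inter> D) * M"
    using full_le by (rule add_left_mono)
  finally show ?thesis by (simp add: algebra_simps)
qed

text \<open>
  A set of \<open>q M\<close> vertices meets at least \<open>q\<close> clusters. One vertex from each of \<open>q\<close> of them gives
  the set \<open>Y\<close>, and all of these clusters are still open.
\<close>

lemma transversal_pick:
  assumes \<C>: "disjoint \<C>" "finite \<C>" "\<And>C. C \<in> \<C> \<Longrightarrow> finite C \<and> card C \<le> M"
    and cap: "\<And>C. C \<in> \<C> \<Longrightarrow> card (C \<inter> D) \<le> s"
    and Z: "Z \<subseteq> available \<C> s D" "q * M \<le> card Z" "M > 0"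
  obtains Y where "Y \<subseteq> Z" "card Y = q" "\<And>C. C \<in> \<C> \<Longrightarrow> card (C \<inter> (D \<union> Y)) \<le> s"
proof -
  define hit where "hit = {C \<in> \<C>. C \<inter> Z \<noteq> {}}"
  have hit: "hit \<subseteq> \<C>" "finite hit" using \<C>(2) by (auto simp: hit_def)
  have "Z \<subseteq> \<Union>hit" using Z(1) available_subset[of \<C> s D] by (fastforce simp: hit_def)
  then have "card Z \<le> card (\<Union>hit)" by (rule card_mono[rotated]) (use \<C> hit in auto)
  also have "\<dots> \<le> (\<Sum>C\<in>hit. card C)" by (rule card_Union_le_sum_card)
  also have "\<dots> \<le> (\<Sum>C\<in>hit. M)" by (rule sum_mono) (use \<C> hit in auto)
  finally have "card Z \<le> card hit * M" by simp
  with Z(2) have "q * M \<le> card hit * M" by (rule order_trans)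
  then have "q \<le> card hit" using Z(3) by simp
  then obtain H where H: "H \<subseteq> hit" "card H = q" by (meson obtain_subset_with_card_n)
  have "\<forall>C\<in>H. \<exists>z. z \<in> C \<inter> Z" using H by (auto simp: hit_def)
  then obtain f where f: "\<And>C. C \<in> H \<Longrightarrow> f C \<in> C \<inter> Z" by metis
  have same: "C = C'" if "x \<in> C" "x \<in> C'" "C \<in> \<C>" "C' \<in> \<C>" for x C C'
    using disjointD[OF \<C>(1), of C C'] that by auto
  have H\<C>: "H \<subseteq> \<C>" using H hit by auto
  have "inj_on f H"
  proof (rule inj_onI)
    fix C C' assume "C \<in> H" "C' \<in> H" "f C = f C'"
    then show "C = C'" using same[of "f C" C C'] f[of C] f[of C'] H\<C> by auto
  qed
  then have card: "card (f ` H) = q" using H by (simp add: card_image)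
  show ?thesis
  proof (rule that[of "f ` H"])
    fix C assume C: "C \<in> \<C>"
    have sub: "C \<inter> f ` H \<subseteq> {f C}" "C \<inter> f ` H \<noteq> {} \<Longrightarrow> C \<in> H"
      using same[of _ C] f H\<C> C by blast+
    show "card (C \<inter> (D \<union> f ` H)) \<le> s"
    proof (cases "C \<inter> f ` H = {}")
      case True
      then have "C \<inter> (D \<union> f ` H) = C \<inter> D" by auto
      then show ?thesis using cap C by simp
    next
      case False
      have fin: "finite (C \<inter> D)" using \<C>(3) C by simp
      have "f C \<in> Z" using f[OF sub(2)[OF False]] by auto
      then obtain C' where C': "C' \<in> \<C>" "card (C' \<inter> D) < s" "f C \<in> C'"
        using Z(1) by (auto simp: available_def)
      then have "C' = C" using same[of "f C" C' C] f[OF sub(2)[OF False]] C by auto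
      then have "card (C \<inter> D) < s" using C' by simp
      have "C \<inter> (D \<union> f ` H) \<subseteq> insert (f C) (C \<inter> D)" using sub(1) by auto
      then have "card (C \<inter> (D \<union> f ` H)) \<le> card (insert (f C) (C \<inter> D))"
        by (rule card_mono[rotated]) (use fin in simp)
      also have "\<dots> \<le> Suc (card (C \<inter> D))" by (rule card_insert_le_m1) auto
      finally show ?thesis using \<open>card (C \<inter> D) < s\<close> by simp
    qed
  qed (use f card in auto)
qed

section \<open>Absorbing the remaining vertices\<close>

definition cells :: "('a set \<times> 'a set) set \<Rightarrow> 'a set set" where
  "cells \<P> = fst ` \<P> \<union> snd ` \<P>"

lemma cells_iff: "C \<in> cells \<P> \<longleftrightarrow> (\<exists>A B. (A, B) \<in> \<P> \<and> (C = A \<or> C = B))"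
  by (force simp: cells_def)

lemma Union_cells [simp]: "\<Union>(cells \<P>) = covered \<P>"
  by (force simp: cells_def covered_def)

lemma cell_subset: "C \<in> cells \<P> \<Longrightarrow> C \<subseteq> covered \<P>"
  by (metis Union_cells Union_upper)

lemma disjoint_cells:
  assumes "bitiling E lo hi \<P>" "irrefl E"
  shows "disjoint (cells \<P>)"
proof (rule disjointI)
  fix C C' assume C: "C \<in> cells \<P>" "C' \<in> cells \<P>" "C \<noteq> C'"
  then obtain A B A' B' where AB: "(A, B) \<in> \<P>" "C = A \<or> C = B" "(A', B') \<in> \<P>" "C' = A' \<or> C' = B'"
    unfolding cells_iff by blast
  show "C \<inter> C' = {}"
  proof (cases "(A, B) = (A', B')")
    case True
    have "A \<inter> B = {}" using bitilingD(1)[OF assms(1) AB(1)] irrefl_Times_disjoint[OF assms(2)] by simp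
    then show ?thesis using True AB C(3) by auto
  next
    case False
    then have "(A \<union> B) \<inter> (A' \<union> B') = {}"
      using assms(1) AB disjoint_family_onD[of "\<lambda>(A, B). A \<union> B" \<P> "(A, B)" "(A', B')"]
      by (simp add: bitiling_def)
    then show ?thesis using AB by auto
  qed
qed

lemma finite_cells: "bitiling E lo hi \<P> \<Longrightarrow> finite (cells \<P>)"
  by (simp add: bitiling_def cells_def)

lemma cellsD:
  assumes "bitiling E lo hi \<P>" "C \<in> cells \<P>"
  shows "finite C \<and> card C \<le> hi"
  using assms by (auto simp: cells_def dest: bitilingD)

lemma bitiling_Diff:
  assumes \<P>: "bitiling E lo hi \<P>" and D: "\<And>C. C \<in> cells \<P> \<Longrightarrow> card (C \<inter> D) \<le> s"
  shows "bitiling E (lo - s) hi ((\<lambda>(A, B). (A - D, B - D)) ` \<P>)"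
    and "covered ((\<lambda>(A, B). (A - D, B - D)) ` \<P>) = covered \<P> - D"
proof -
  show "covered ((\<lambda>(A, B). (A - D, B - D)) ` \<P>) = covered \<P> - D"
    by (auto simp: covered_def)
  have disj: "disjoint_family_on (\<lambda>(A, B). A \<union> B) ((\<lambda>(A, B). (A - D, B - D)) ` \<P>)"
    unfolding disjoint_family_on_def
  proof (intro ballI impI)
    fix X Y assume "X \<in> (\<lambda>(A, B). (A - D, B - D)) ` \<P>" "Y \<in> (\<lambda>(A, B). (A - D, B - D)) ` \<P>" "X \<noteq> Y"
    then obtain A B A' B' where AB: "(A, B) \<in> \<P>" "X = (A - D, B - D)"
      "(A', B') \<in> \<P>" "Y = (A' - D, B' - D)" "(A, B) \<noteq> (A', B')" by auto
    then have "(A \<union> B) \<inter> (A' \<union> B') = {}"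
      using \<P> disjoint_family_onD[of "\<lambda>(A, B). A \<union> B" \<P> "(A, B)" "(A', B')"]
      by (simp add: bitiling_def)
    then show "(\<lambda>(A, B). A \<union> B) X \<inter> (\<lambda>(A, B). A \<union> B) Y = {}" using AB by auto
  qed
  have "finite (C - D) \<and> card (C - D) \<in> {lo - s..hi}"
    if C: "C \<in> cells \<P>" and c: "finite C" "card C \<in> {lo..hi}" for C
  proof -
    have "card (C - D) = card C - card (C \<inter> D)" by (rule card_Diff_subset_Int) (use c in simp)
    then show ?thesis using D[OF C] c by auto
  qed
  note size = this
  have "A \<in> cells \<P>" "B \<in> cells \<P>" if "(A, B) \<in> \<P>" for A B
    using that by (force simp: cells_def)+
  then have "(A - D) \<times> (B - D) \<subseteq> E \<and> finite (A - D) \<and> finite (B - D) \<and>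
      card (A - D) \<in> {lo - s..hi} \<and> card (B - D) \<in> {lo - s..hi}" if "(A, B) \<in> \<P>" for A B
    using size[of A] size[of B] bitilingD(1-5)[OF \<P> that] that by blast
  note pair = this
  show "bitiling E (lo - s) hi ((\<lambda>(A, B). (A - D, B - D)) ` \<P>)"
    unfolding bitiling_def
  proof (intro conjI disj ballI)
    show "finite ((\<lambda>(A, B). (A - D, B - D)) ` \<P>)" using bitiling_finite[OF \<P>] by simp
    fix X assume "X \<in> (\<lambda>(A, B). (A - D, B - D)) ` \<P>"
    then obtain A B where AB: "(A, B) \<in> \<P>" and X: "X = (A - D, B - D)" by auto
    show "case X of (A, B) \<Rightarrow> A \<times> B \<subseteq> E \<and> finite A \<and> finite B \<and>
        card A \<in> {lo - s..hi} \<and> card B \<in> {lo - s..hi}"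
      unfolding X prod.case by (rule pair[OF AB])
  qed
qed

lemma card_not_available:
  assumes \<C>: "disjoint \<C>" "finite \<C>" "\<And>C. C \<in> \<C> \<Longrightarrow> finite C \<and> card C \<le> M" and D: "finite D"
    and s: "s > 0" "M \<le> L * s" and V: "finite V" "\<Union>\<C> \<subseteq> V"
    and a: "real (card (V - \<Union>\<C>)) \<le> a" and b: "real (card (\<Union>\<C> \<inter> D)) \<le> b"
  shows "real (card (V - available \<C> s D)) \<le> a + (1 + real L) * b"
proof -
  have "s * card (\<Union>\<C> - available \<C> s D) \<le> (s + M) * card (\<Union>\<C> \<inter> D)"
    by (rule card_unavailable[OF \<C> D])
  also have "\<dots> \<le> (s + L * s) * card (\<Union>\<C> \<inter> D)" by (rule mult_right_mono) (use s in auto)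
  also have "\<dots> = s * ((1 + L) * card (\<Union>\<C> \<inter> D))" by (simp add: algebra_simps)
  finally have "card (\<Union>\<C> - available \<C> s D) \<le> (1 + L) * card (\<Union>\<C> \<inter> D)"
    by (simp only: mult_le_cancel1 s(1) simp_thms)
  then have "real (card (\<Union>\<C> - available \<C> s D)) \<le> real ((1 + L) * card (\<Union>\<C> \<inter> D))"
    by (simp only: of_nat_le_iff)
  also have "\<dots> = (1 + real L) * card (\<Union>\<C> \<inter> D)" by (simp add: algebra_simps)
  also have "\<dots> \<le> (1 + real L) * b" by (rule mult_left_mono) (use b in auto)
  finally have 1: "real (card (\<Union>\<C> - available \<C> s D)) \<le> (1 + real L) * b" .
  have "V - available \<C> s D \<subseteq> (V - \<Union>\<C>) \<union> (\<Union>\<C> - available \<C> s D)"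
    by auto
  then have "card (V - available \<C> s D) \<le> card ((V - \<Union>\<C>) \<union> (\<Union>\<C> - available \<C> s D))"
    by (rule card_mono[rotated]) (use V(1) finite_subset[OF V(2,1)] in auto)
  also have "\<dots> \<le> card (V - \<Union>\<C>) + card (\<Union>\<C> - available \<C> s D)" by (rule card_Un_le)
  finally show ?thesis using 1 a by linarith
qed

context dense_graph begin

text \<open>
  \<open>\<N>\<close> holds the additional pairs. They may reuse vertices covered by \<open>\<P>\<close>, and the pairs of \<open>\<P>\<close>
  will give these up; the upper bound \<open>M + 1\<close> leaves room for a single extra vertex.
\<close>

definition absorbing :: "('a set \<times> 'a set) set \<Rightarrow> nat \<Rightarrow> nat \<Rightarrow> ('a set \<times> 'a set) set \<Rightarrow> bool" where
  "absorbing \<P> M s \<N> \<longleftrightarrow> bitiling E M (M + 1) \<N> \<and> covered \<N> \<subseteq> V \<and>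
     (\<forall>C\<in>cells \<P>. card (C \<inter> covered \<N>) \<le> s)"

text \<open>
  Every pair that is added takes \<open>M\<close> vertices from the uncovered part and \<open>M\<close> from the clusters, so
  in total the clusters lose no more vertices than were uncovered at the beginning. This keeps almost
  all vertices available throughout.
\<close>

lemma absorb_chunks:
  fixes p r M L :: nat and a :: real
  assumes \<P>: "bitiling E M M \<P>" "covered \<P> \<subseteq> V" and left: "real (card (V - covered \<P>)) \<le> a"
    and p: "p = r * M" "M > 0" and r: "2 \<le> \<epsilon> * r" and s: "s > 0" "M \<le> L * s"
    and a: "a + (1 + real L) * a \<le> \<epsilon> / 2 * card V"
    and large: "real (M * M) * 4 ^ p \<le> \<epsilon> / 8 * card V"
  obtains \<N> where "absorbing \<P> M s \<N>" "card (V - covered \<P> - covered \<N>) < p"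
    "real (card (covered \<P> \<inter> covered \<N>)) \<le> a"
proof -
  define W where "W = covered \<P>"
  note cells = disjoint_cells[OF \<P>(1) irrefl_E] finite_cells[OF \<P>(1)] cellsD[OF \<P>(1)]
  have r0: "r > 0" using r by (cases r) auto
  have p0: "p > 0" and MM: "M * M > 0" using p r0 by simp_all
  have q: "2 * real M \<le> \<epsilon> * p" using mult_right_mono[OF r, of M] by (simp add: p)
  have "\<exists>\<N>. absorbing \<P> M s \<N> \<and> card (V - W - covered \<N>) < p \<and>
      card (W \<inter> covered \<N>) \<le> card ((V - W) \<inter> covered \<N>)"
    if "absorbing \<P> M s \<N>" "card (W \<inter> covered \<N>) \<le> card ((V - W) \<inter> covered \<N>)" for \<N>
    using that
  proof (induction "card (V - W - covered \<N>)" arbitrary: \<N> rule: less_induct)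
    case less
    define D where "D = covered \<N>"
    note \<N> = less.prems[unfolded absorbing_def, folded D_def]
    have finD: "finite D" using \<N> finite_V finite_subset by auto
    show ?case
    proof (cases "card (V - W - D) < p")
      case True
      then show ?thesis using less.prems by (auto simp: D_def)
    next
      case False
      then obtain X where X: "X \<subseteq> V - W - D" "card X = p"
        by (meson not_le obtain_subset_with_card_n)
      define A where "A = available (cells \<P>) s D"
      have A: "A \<subseteq> W - D" using available_subset[of "cells \<P>" s D] by (simp add: A_def W_def)
      have "card ((V - W) \<inter> D) \<le> card (V - W)" by (rule card_mono) (use finite_V in auto)
      then have b: "real (card (\<Union>(cells \<P>) \<inter> D)) \<le> a"
        using \<N>(2) left by (simp add: W_def)
      have VA: "real (card (V - A)) \<le> \<epsilon> / 2 * card V"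
        using card_not_available[OF cells finD s finite_V _ _ b, of a] \<P>(2) left a
        by (simp add: A_def)
      have AV: "A \<subseteq> V" and XV: "X \<subseteq> V" using A X(1) \<P>(2) by (auto simp: W_def)
      \<comment> \<open>With \<open>M\<^sup>2\<close> common neighbours at hand, \<open>M\<close> of them can be chosen in different clusters.\<close>
      obtain X' X'' Z where conn: "X' \<subseteq> X" "X'' \<subseteq> X" "Z \<subseteq> A" "card X' = M" "card X'' = M"
        "card Z = M * M" "X' \<times> Z \<subseteq> E" "Z \<times> X'' \<subseteq> E"
        by (rule connect[OF AV VA XV X(2) XV X(2) p0 MM q large])
      note Z = conn(1,3,4,6,7)
      obtain Y where Y: "Y \<subseteq> Z" "card Y = M" "\<And>C. C \<in> cells \<P> \<Longrightarrow> card (C \<inter> (D \<union> Y)) \<le> s"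
        using transversal_pick[OF cells, of D s Z M] \<N>(1) Z(2,4) p(2) by (auto simp: A_def)
      have sub: "X' \<subseteq> V - W - D" "Y \<subseteq> W - D" "W \<subseteq> V" using X Z Y A \<P>(2) by (auto simp: W_def)
      have fin: "finite X'" "finite Y" 
        using sub finite_V finite_subset[of X' V] finite_subset[of Y V] by auto
      define \<N>' where "\<N>' = insert (X', Y) \<N>"
      have cov: "covered \<N>' = D \<union> (X' \<union> Y)" by (auto simp: \<N>'_def D_def)
      have C: "C \<inter> covered \<N>' = C \<inter> (D \<union> Y)" if "C \<in> cells \<P>" for C
      proof -
        have "C \<subseteq> W" using cell_subset[OF that] by (simp add: W_def)
        then show ?thesis using sub(1) by (auto simp: cov)
      qed
      have "absorbing \<P> M s \<N>'" unfolding absorbing_def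
      proof (intro conjI ballI)
        show "bitiling E M (M + 1) \<N>'" unfolding \<N>'_def
          by (rule bitiling_insert) (use \<N>(1) Z Y sub fin in \<open>auto simp: D_def\<close>)
        show "covered \<N>' \<subseteq> V" using \<N>(1) sub by (auto simp: cov)
        show "card (C \<inter> covered \<N>') \<le> s" if "C \<in> cells \<P>" for C
          using Y(3)[OF that] C[OF that] by simp
      qed
      moreover have "card (W \<inter> covered \<N>') \<le> card ((V - W) \<inter> covered \<N>')"
      proof -
        have "W \<inter> covered \<N>' = (W \<inter> D) \<union> Y" "(V - W) \<inter> covered \<N>' = ((V - W) \<inter> D) \<union> X'"
          using sub by (auto simp: cov)
        moreover have "card ((W \<inter> D) \<union> Y) = card (W \<inter> D) + card Y"
          by (rule card_Un_disjoint) (use sub fin finD in auto)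
        moreover have "card (((V - W) \<inter> D) \<union> X') = card ((V - W) \<inter> D) + card X'"
          by (rule card_Un_disjoint) (use sub fin finD in auto)
        ultimately show ?thesis using \<N>(2) Z(3) Y(2) by simp
      qed
      moreover have "card (V - W - covered \<N>') < card (V - W - covered \<N>)"
      proof (rule psubset_card_mono)
        have "X' \<noteq> {}" using Z(3) p(2) by auto
        then show "V - W - covered \<N>' \<subset> V - W - covered \<N>"
          using sub(1) by (auto simp: cov simp flip: D_def)
      qed (use finite_V in auto)
      ultimately show ?thesis using less.hyps by blast
    qed
  qed
  moreover have "absorbing \<P> M s {}" by (simp add: absorbing_def)
  ultimately obtain \<N> where \<N>: "absorbing \<P> M s \<N>" "card (V - W - covered \<N>) < p"
      "card (W \<inter> covered \<N>) \<le> card ((V - W) \<inter> covered \<N>)" by fastforce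
  have "card ((V - W) \<inter> covered \<N>) \<le> card (V - W)" by (rule card_mono) (use finite_V in auto)
  then have "real (card (W \<inter> covered \<N>)) \<le> a" using \<N>(3) left by (simp add: W_def)
  then show ?thesis using that \<N> by (simp add: W_def)
qed

text \<open>
  For an uncovered vertex \<open>v\<close> first take a set \<open>Y\<close> of neighbours, then a proportion \<open>Y' \<subseteq> Y\<close> with
  many common neighbours, and join \<open>v\<close> to a set \<open>X\<close> of \<open>M\<close> of these: \<open>(X \<union> {v}, Y')\<close> is a
  complete pair. The budget \<open>b\<close> charges \<open>2 M\<close> lost cluster vertices to each \<open>v\<close>.
\<close>

lemma absorb_vertices:
  fixes p r M L b :: nat and a :: real
  assumes \<P>: "bitiling E M M \<P>" "covered \<P> \<subseteq> V" and left: "real (card (V - covered \<P>)) \<le> a"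
    and p: "p = r * M" "M > 0" and r: "2 \<le> \<epsilon> * r" and s: "s > 0" "M \<le> L * s"
    and a: "a + (1 + real L) * (real b + p) \<le> \<epsilon> / 2 * card V"
    and large: "real (M * M) * 4 ^ p \<le> \<epsilon> / 8 * card V" "real (p * M) \<le> card V / 2"
    and \<N>: "absorbing \<P> M s \<N>"
      "card (covered \<P> \<inter> covered \<N>) + 2 * M * card (V - covered \<P> - covered \<N>) \<le> b"
  obtains \<N>' where "absorbing \<P> M s \<N>'" "V \<subseteq> covered \<P> \<union> covered \<N>'"
proof -
  define W where "W = covered \<P>"
  note cells = disjoint_cells[OF \<P>(1) irrefl_E] finite_cells[OF \<P>(1)] cellsD[OF \<P>(1)]
  have r0: "r > 0" using r by (cases r) auto
  have p0: "p > 0" and MM: "M * M > 0" using p r0 by simp_all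
  have q: "2 * real M \<le> \<epsilon> * p" using mult_right_mono[OF r, of M] by (simp add: p)
  have WV: "W \<subseteq> V" "finite W" using \<P>(2) finite_V finite_subset by (auto simp: W_def)
  have CW: "C \<subseteq> W" if "C \<in> cells \<P>" for C using cell_subset[OF that] by (simp add: W_def)
  have unav: "real (card (V - available (cells \<P>) s D)) \<le> \<epsilon> / 2 * card V"
    if D: "D \<subseteq> V" "card (W \<inter> D) \<le> b + p" for D
  proof -
    have fin: "finite D" using D finite_V finite_subset by auto
    have b: "real (card (\<Union>(cells \<P>) \<inter> D)) \<le> real b + p"
      using D(2) by (simp add: W_def flip: of_nat_add)
    show ?thesis using card_not_available[OF cells fin s finite_V _ _ b, of a] \<P>(2) left a by simp
  qed
  have "\<exists>\<N>'. absorbing \<P> M s \<N>' \<and> V \<subseteq> W \<union> covered \<N>'"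
    using \<N>[folded W_def]
  proof (induction "card (V - W - covered \<N>)" arbitrary: \<N> rule: less_induct)
    case less
    define D where "D = covered \<N>"
    note \<N> = less.prems[unfolded absorbing_def, folded D_def]
    have DV: "D \<subseteq> V" "finite D" using \<N> finite_V finite_subset by auto
    show ?case
    proof (cases "V - W - D = {}")
      case True
      then show ?thesis using less.prems by (auto simp: D_def)
    next
      case False
      then obtain v where v: "v \<in> V" "v \<notin> W" "v \<notin> D" by auto
      define A where "A = available (cells \<P>) s D"
      have A: "A \<subseteq> W - D" using available_subset[of "cells \<P>" s D] by (simp add: A_def W_def)
      have VA: "real (card (V - A)) \<le> \<epsilon> / 2 * card V"
        unfolding A_def by (rule unav) (use DV \<N>(2) in auto)
      have "(1 / 2 + \<epsilon>) * card V - \<epsilon> / 2 * card V \<le> card (A \<inter> E `` {v})"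
        by (rule degree_into[OF v(1) _ VA]) (use A WV in auto)
      moreover have "(1 / 2 + \<epsilon>) * card V - \<epsilon> / 2 * card V = card V / 2 + \<epsilon> / 2 * card V"
        by (simp add: algebra_simps)
      moreover have "0 \<le> \<epsilon> / 2 * card V" using \<epsilon>_pos by simp
      ultimately have "real (p * M) \<le> card (A \<inter> E `` {v})" using large(2) by linarith
      then have "p * M \<le> card (A \<inter> E `` {v})" by (simp only: of_nat_le_iff)
      then obtain Y where Y: "Y \<subseteq> A \<inter> E `` {v}" "card Y = p"
        "\<And>C. C \<in> cells \<P> \<Longrightarrow> card (C \<inter> (D \<union> Y)) \<le> s"
        using transversal_pick[OF cells, of D s "A \<inter> E `` {v}" p] \<N>(1) p(2)
        by (auto simp: A_def)
      have YW: "Y \<subseteq> W - D" using Y A by auto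
      have finY: "finite Y" using finite_subset[of Y W] YW WV by auto
      define A' where "A' = available (cells \<P>) s (D \<union> Y)"
      have A': "A' \<subseteq> W - (D \<union> Y)"
        using available_subset[of "cells \<P>" s "D \<union> Y"] by (simp add: A'_def W_def)
      have VA': "real (card (V - A')) \<le> \<epsilon> / 2 * card V"
        unfolding A'_def
      proof (rule unav)
        have "W \<inter> (D \<union> Y) \<subseteq> (W \<inter> D) \<union> Y" by auto
        then have "card (W \<inter> (D \<union> Y)) \<le> card ((W \<inter> D) \<union> Y)"
          by (rule card_mono[rotated]) (use finY DV in auto)
        also have "\<dots> \<le> card (W \<inter> D) + card Y" by (rule card_Un_le)
        finally show "card (W \<inter> (D \<union> Y)) \<le> b + p" using \<N>(2) Y(2) by simp
      qed (use DV YW WV in auto)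
      have AV: "A' \<subseteq> V" and YV: "Y \<subseteq> V" using A' YW WV by auto
      obtain Y'' Y' Z where conn: "Y'' \<subseteq> Y" "Y' \<subseteq> Y" "Z \<subseteq> A'" "card Y'' = M" "card Y' = M"
        "card Z = M * M" "Y'' \<times> Z \<subseteq> E" "Z \<times> Y' \<subseteq> E"
        by (rule connect[OF AV VA' YV Y(2) YV Y(2) p0 MM q large(1)])
      note Z = conn(2,3,5,6,8)
      obtain X where X: "X \<subseteq> Z" "card X = M" "\<And>C. C \<in> cells \<P> \<Longrightarrow> card (C \<inter> ((D \<union> Y) \<union> X)) \<le> s"
        using transversal_pick[OF cells, of "D \<union> Y" s Z M] Y(3) Z(2,4) p(2) by (auto simp: A'_def)
      have sub: "X \<subseteq> W - (D \<union> Y)" "Y' \<subseteq> W - D" using X Z A' YW by auto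
      have fin: "finite X" "finite Y'" using sub WV finite_subset[of X W] finite_subset[of Y' W] by auto
      have vX: "v \<notin> X" "v \<notin> Y'" using sub v by auto
      define \<N>' where "\<N>' = insert (insert v X, Y') \<N>"
      have cov: "covered \<N>' = insert v (D \<union> Y' \<union> X)" by (auto simp: \<N>'_def D_def)
      have "absorbing \<P> M s \<N>'" unfolding absorbing_def
      proof (intro conjI ballI)
        show "bitiling E M (M + 1) \<N>'" unfolding \<N>'_def
          by (rule bitiling_insert) (use \<N>(1) Z(1,3,5) X Y(1) sub fin vX v in \<open>auto simp: D_def\<close>)
        show "covered \<N>' \<subseteq> V" using DV v sub WV by (auto simp: cov)
        fix C assume C: "C \<in> cells \<P>"
        have "C \<inter> covered \<N>' \<subseteq> C \<inter> ((D \<union> Y) \<union> X)" using CW[OF C] v Z(1) by (auto simp: cov)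
        moreover have "finite (C \<inter> ((D \<union> Y) \<union> X))" using finite_subset[OF CW[OF C] WV(2)] by simp
        ultimately have "card (C \<inter> covered \<N>') \<le> card (C \<inter> ((D \<union> Y) \<union> X))" by (rule card_mono[rotated])
        then show "card (C \<inter> covered \<N>') \<le> s" using X(3)[OF C] by simp
      qed
      moreover have smaller: "card (V - W - covered \<N>') < card (V - W - covered \<N>)"
        by (rule psubset_card_mono) (use finite_V v in \<open>auto simp: cov simp flip: D_def\<close>)
      moreover have "card (W \<inter> covered \<N>') + 2 * M * card (V - W - covered \<N>') \<le> b"
      proof -
        have "W \<inter> covered \<N>' = (W \<inter> D) \<union> (Y' \<union> X)" using sub v by (auto simp: cov)
        then have "card (W \<inter> covered \<N>') \<le> card (W \<inter> D) + card (Y' \<union> X)"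
          using card_Un_le by metis
        also have "card (Y' \<union> X) \<le> M + M" using card_Un_le[of Y' X] Z X by simp
        finally have "card (W \<inter> covered \<N>') \<le> card (W \<inter> D) + 2 * M" by simp
        moreover have "2 * M * Suc (card (V - W - covered \<N>')) \<le> 2 * M * card (V - W - D)"
          using smaller unfolding D_def by (intro mult_left_mono) auto
        ultimately show ?thesis using \<N>(2) by simp
      qed
      ultimately show ?thesis using less.hyps by blast
    qed
  qed
  then show ?thesis using that by (auto simp: W_def)
qed

text \<open>
  The pairs of the tiling, deprived of the vertices reused for absorption, together with the absorbing
  pairs. The single exponential bound on \<open>n\<close> implies every largeness condition of the preceding
  lemmas, because all quantities in them are bounded by products of a few factors \<open>2 ^ (r * M)\<close>.
\<close>

lemma perfect_pair_tiling:
  fixes \<gamma> :: real and r k s L M :: nat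
  assumes \<gamma>: "0 < \<gamma>" "\<gamma> \<le> 1 / 2" "(real L + 2) * \<gamma> \<le> \<epsilon> / 4"
    and r: "2 \<le> \<epsilon> * r" and k: "4 * (r + 1) \<le> \<epsilon> * k"
    and s: "s > 0" and M: "M = L * s" "L > 0"
    and large: "16 ^ (r ^ k * M) \<le> \<epsilon> * \<gamma> / 4 * card V"
  obtains \<Q> where "bitiling E (M - s) (M + 1) \<Q>" "covered \<Q> = V"
proof -
  have r4: "r \<ge> 4" by (rule four_le_ratio[OF r])
  have k0: "k > 0" using k by (cases k) auto
  define p where "p = r * M"
  have M0: "M > 0" using s M by simp
  have px: "p \<le> r ^ k * M" unfolding p_def using self_le_power[of r k] r4 k0 by simp
  have "(16::real) ^ p \<le> 16 ^ (r ^ k * M)" using px by (rule power_increasing) simp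
  then have big: "16 ^ p \<le> \<epsilon> * \<gamma> / 4 * card V" using large by linarith
  have c8: "\<epsilon> * \<gamma> / 4 * card V \<le> \<epsilon> / 8 * card V"
    using mult_left_mono[OF \<gamma>(2), of "\<epsilon> / 4"] \<epsilon>_pos by (intro mult_right_mono) auto
  have e2: "\<epsilon> / 8 * card V \<le> 1 / 2 * card V"
    using \<epsilon>_le by (intro mult_right_mono) auto
  have Mp: "4 * M \<le> p" using r4 by (simp add: p_def)
  have p2: "p < 2 ^ p" by (rule less_exp)
  have pow: "(2::nat) ^ p * 2 ^ p * 4 ^ p = 16 ^ p" "(2::nat) ^ p * 2 ^ p * 2 ^ p \<le> 16 ^ p"
    by (simp_all add: power_mult_distrib[symmetric] power_mono)
  have "L \<le> M" using M s by simp
  then have small: "M \<le> 2 ^ p" "1 + L \<le> 2 ^ p" "2 * M + 1 \<le> 2 ^ p" "p \<le> 2 ^ p"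
    using Mp p2 M0 by linarith+
  have "M * M * 4 ^ p \<le> 2 ^ p * 2 ^ p * 4 ^ p"
    by (intro mult_mono) (use small in auto)
  then have "real (M * M * 4 ^ p) \<le> real (16 ^ p)" unfolding pow(1) by (simp only: of_nat_le_iff)
  then have l1: "real (M * M) * 4 ^ p \<le> \<epsilon> / 8 * card V" using big c8 by simp
  have "(1 + L) * (2 * M + 1) * p \<le> 2 ^ p * 2 ^ p * 2 ^ p"
    by (intro mult_mono) (use small in auto)
  then have "(1 + L) * (2 * M + 1) * p \<le> 16 ^ p" using pow(2) by linarith
  then have "real ((1 + L) * (2 * M + 1) * p) \<le> real (16 ^ p)" by (simp only: of_nat_le_iff)
  then have l2: "(1 + real L) * ((2 * real M + 1) * real p) \<le> \<epsilon> / 8 * card V"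
    using big c8 by (simp add: algebra_simps)
  have "p * M \<le> 2 ^ p * 2 ^ p * 2 ^ p"
  proof -
    have "p * M \<le> 2 ^ p * 2 ^ p" by (intro mult_mono) (use small in auto)
    also have "\<dots> \<le> 2 ^ p * 2 ^ p * 2 ^ p" by simp
    finally show ?thesis .
  qed
  then have "p * M \<le> 16 ^ p" using pow(2) by linarith
  then have "real (p * M) \<le> real (16 ^ p)" by (simp only: of_nat_le_iff)
  then have l3: "real (p * M) \<le> card V / 2" using big c8 e2 by simp
  have "(8::real) ^ (r ^ k * M) \<le> 16 ^ (r ^ k * M)" by (rule power_mono) auto
  then have l8: "8 ^ (r ^ k * M) \<le> \<epsilon> * \<gamma> / 4 * card V" using large by linarith
  obtain \<P> where \<P>: "bitiling E M M \<P>" "covered \<P> \<subseteq> V" "(1 - \<gamma>) * card V \<le> card (covered \<P>)"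
    by (rule almost_perfect_tiling[OF \<gamma>(1,2) r k M0 l8])
  have "card (V - covered \<P>) = card V - card (covered \<P>)"
    using finite_covered[OF \<P>(1)] \<P>(2) by (rule card_Diff_subset)
  then have left: "real (card (V - covered \<P>)) \<le> \<gamma> * card V"
    using \<P>(3) card_mono[OF finite_V \<P>(2)] by (simp add: of_nat_diff algebra_simps)
  have split: "\<gamma> * card V + (1 + real L) * (\<gamma> * card V) = (real L + 2) * \<gamma> * card V"
    by (simp add: algebra_simps)
  have quarter: "(real L + 2) * \<gamma> * card V \<le> \<epsilon> / 4 * card V"
    by (rule mult_right_mono) (use \<gamma> in auto)
  have eV: "0 \<le> \<epsilon> * card V" using \<epsilon>_pos by simp
  have sM: "M \<le> L * s" using M by simp
  have a1: "\<gamma> * card V + (1 + real L) * (\<gamma> * card V) \<le> \<epsilon> / 2 * card V"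
    using split quarter eV by linarith
  obtain \<N> where \<N>: "absorbing \<P> M s \<N>" "card (V - covered \<P> - covered \<N>) < p"
    "real (card (covered \<P> \<inter> covered \<N>)) \<le> \<gamma> * card V"
    by (rule absorb_chunks[OF \<P>(1,2) left p_def M0 r s sM a1 l1])
  define b where "b = card (covered \<P> \<inter> covered \<N>) + 2 * M * p"
  have "(1 + real L) * (real b + p)
      \<le> (1 + real L) * (\<gamma> * card V + (2 * real M + 1) * real p)"
    by (rule mult_left_mono) (use \<N>(3) in \<open>auto simp: b_def algebra_simps\<close>)
  also have "\<dots> = (1 + real L) * (\<gamma> * card V) + (1 + real L) * ((2 * real M + 1) * real p)"
    by (simp only: distrib_left)
  finally have a2: "\<gamma> * card V + (1 + real L) * (real b + p) \<le> \<epsilon> / 2 * card V"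
    using l2 split quarter eV by linarith
  have b: "card (covered \<P> \<inter> covered \<N>) + 2 * M * card (V - covered \<P> - covered \<N>) \<le> b"
    unfolding b_def using \<N>(2) by (intro add_left_mono mult_left_mono) auto
  obtain \<N>' where \<N>': "absorbing \<P> M s \<N>'" "V \<subseteq> covered \<P> \<union> covered \<N>'"
    by (rule absorb_vertices[OF \<P>(1,2) left p_def M0 r s sM a2 l1 l3 \<N>(1) b])
  define D where "D = covered \<N>'"
  have D: "bitiling E M (M + 1) \<N>'" "D \<subseteq> V" "\<And>C. C \<in> cells \<P> \<Longrightarrow> card (C \<inter> D) \<le> s"
    using \<N>'(1) by (auto simp: absorbing_def D_def)
  define \<P>' where "\<P>' = (\<lambda>(A, B). (A - D, B - D)) ` \<P>"
  have P': "bitiling E (M - s) M \<P>'" "covered \<P>' = covered \<P> - D"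
    using bitiling_Diff[OF \<P>(1) D(3)] by (auto simp: \<P>'_def)
  show ?thesis
  proof (rule that)
    show "bitiling E (M - s) (M + 1) (\<P>' \<union> \<N>')"
    proof (rule bitiling_Un)
      show "bitiling E (M - s) (M + 1) \<P>'" by (rule bitiling_mono[OF P'(1)]) auto
      show "bitiling E (M - s) (M + 1) \<N>'" by (rule bitiling_mono[OF D(1)]) auto
    qed (use P' in \<open>auto simp: D_def\<close>)
    show "covered (\<P>' \<union> \<N>') = V" using P' \<P>(2) D(2) \<N>'(2) by (auto simp: D_def)
  qed
qed

end

section \<open>Linking the pairs to a cycle\<close>

lemma successively_concat_upt:
  assumes "\<And>i. i < N \<Longrightarrow> f i \<noteq> [] \<and> successively R (f i)"
    and "\<And>i. Suc i < N \<Longrightarrow> R (last (f i)) (hd (f (Suc i)))"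
  shows "successively R (concat (map f [0..<N])) \<and>
    (N > 0 \<longrightarrow> concat (map f [0..<N]) \<noteq> [] \<and> hd (concat (map f [0..<N])) = hd (f 0) \<and>
      last (concat (map f [0..<N])) = last (f (N - 1)))"
  using assms
proof (induction N)
  case (Suc N)
  show ?case
  proof (cases "N = 0")
    case True
    then show ?thesis using Suc.prems(1)[of 0] by simp
  next
    case False
    define c where "c = concat (map f [0..<N])"
    have c: "successively R c" "c \<noteq> []" "hd c = hd (f 0)" "last c = last (f (N - 1))"
      using Suc.IH Suc.prems False by (auto simp: c_def)
    have "R (last c) (hd (f N))" using Suc.prems(2)[of "N - 1"] c False by simp
    moreover have "concat (map f [0..<Suc N]) = c @ f N" by (simp add: c_def)
    ultimately show ?thesis
      using c Suc.prems(1)[of N] by (simp add: successively_append_iff)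
  qed
qed simp

lemma sorted_wrt_concat_upt:
  assumes "\<And>i. i < N \<Longrightarrow> sorted_wrt R (f i)"
    and "\<And>i j x y. i < j \<Longrightarrow> j < N \<Longrightarrow> x \<in> set (f i) \<Longrightarrow> y \<in> set (f j) \<Longrightarrow> R x y"
  shows "sorted_wrt R (concat (map f [0..<N]))"
  using assms
proof (induction N)
  case (Suc N)
  then have "sorted_wrt R (concat (map f [0..<N]))" by simp
  moreover have "R x y" if "x \<in> set (concat (map f [0..<N]))" "y \<in> set (f N)" for x y
    using that Suc.prems(2) by auto
  ultimately show ?case using Suc.prems(1)[of N] by (simp add: sorted_wrt_append)
qed simp

text \<open>
  Induction on the number of parts: the first part is taken just large enough that the others can hold
  the rest.
\<close>

lemma partition_into_sized_parts:
  assumes "finite S" "lo * t \<le> card S" "card S \<le> hi * t" "lo \<le> hi"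
  obtains A :: "nat \<Rightarrow> 'a set" where "\<And>j. j < t \<Longrightarrow> lo \<le> card (A j) \<and> card (A j) \<le> hi"
    "(\<Union>j<t. A j) = S" "\<And>i j. i < j \<Longrightarrow> j < t \<Longrightarrow> A i \<inter> A j = {}"
proof -
  have "\<exists>A :: nat \<Rightarrow> 'a set. (\<forall>j<t. lo \<le> card (A j) \<and> card (A j) \<le> hi) \<and>
      (\<Union>j<t. A j) = S \<and> (\<forall>j<t. \<forall>i<j. A i \<inter> A j = {})"
    using assms(1-3)
  proof (induction t arbitrary: S)
    case 0
    then show ?case by simp
  next
    case (Suc t)
    define q where "q = max lo (card S - hi * t)"
    have q: "lo \<le> q" "q \<le> hi" "q \<le> card S" "lo * t \<le> card S - q" "card S - q \<le> hi * t"
      using Suc.prems(2,3) assms(4) mult_le_mono1[OF assms(4), of t]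
      unfolding q_def mult_Suc_right by linarith+
    obtain T where T: "T \<subseteq> S" "card T = q" using q(3) by (meson obtain_subset_with_card_n)
    then have c: "card (S - T) = card S - q"
      using Suc.prems(1) finite_subset by (metis card_Diff_subset)
    have "finite (S - T)" "lo * t \<le> card (S - T)" "card (S - T) \<le> hi * t"
      using Suc.prems(1) c q by auto
    from Suc.IH[OF this] obtain A :: "nat \<Rightarrow> 'a set" where A:
      "\<forall>j<t. lo \<le> card (A j) \<and> card (A j) \<le> hi" "(\<Union>j<t. A j) = S - T"
      "\<forall>j<t. \<forall>i<j. A i \<inter> A j = {}" by blast
    have sub: "A i \<subseteq> S - T" if "i < t" for i using A(2) that by auto
    show ?case
    proof (intro exI[of _ "A(t := T)"] conjI allI impI)
      show "(\<Union>j<Suc t. (A(t := T)) j) = S" using A(2) T(1) by (auto simp: lessThan_Suc)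
      fix j assume j: "j < Suc t"
      show "lo \<le> card ((A(t := T)) j)" "card ((A(t := T)) j) \<le> hi"
        using A(1) T(2) q(1,2) j by (auto simp: less_Suc_eq)
      show "(A(t := T)) i \<inter> (A(t := T)) j = {}" if "i < j" for i
        using that j A(3) sub[of i] by (auto simp: less_Suc_eq)
    qed
  qed
  then obtain A :: "nat \<Rightarrow> 'a set" where "(\<forall>j<t. lo \<le> card (A j) \<and> card (A j) \<le> hi) \<and>
      (\<Union>j<t. A j) = S \<and> (\<forall>j<t. \<forall>i<j. A i \<inter> A j = {})" by blast
  then show ?thesis by (intro that[of A]) auto
qed

text \<open>
  Cut \<open>P\<close> and \<open>Q\<close> into \<open>t\<close> parts each and alternate between the two sides.
\<close>

lemma zigzag:
  assumes "t > 0" "finite P" "finite Q" "P \<times> Q \<subseteq> E" "sym E" "irrefl E" "lo \<le> hi"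
    "lo * t \<le> card P" "card P \<le> hi * t" "lo * t \<le> card Q" "card Q \<le> hi * t"
  obtains L where "L \<noteq> []" "successively (\<lambda>X Y. X \<times> Y \<subseteq> E) L" "hd L \<subseteq> Q" "last L \<subseteq> P"
    "sorted_wrt (\<lambda>X Y. X \<inter> Y = {}) L" "\<Union>(set L) = P \<union> Q"
    "\<And>X. X \<in> set L \<Longrightarrow> lo \<le> card X \<and> card X \<le> hi"
proof -
  obtain A where A: "\<And>j. j < t \<Longrightarrow> lo \<le> card (A j) \<and> card (A j) \<le> hi"
    "(\<Union>j<t. A j) = P" "\<And>i j. i < j \<Longrightarrow> j < t \<Longrightarrow> A i \<inter> A j = {}"
    using partition_into_sized_parts[of P lo t hi] assms by metis
  obtain B where B: "\<And>j. j < t \<Longrightarrow> lo \<le> card (B j) \<and> card (B j) \<le> hi"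
    "(\<Union>j<t. B j) = Q" "\<And>i j. i < j \<Longrightarrow> j < t \<Longrightarrow> B i \<inter> B j = {}"
    using partition_into_sized_parts[of Q lo t hi] assms by metis
  have sub: "A j \<subseteq> P" "B j \<subseteq> Q" if "j < t" for j using A(2) B(2) that by auto
  have PQ: "P \<inter> Q = {}" using irrefl_Times_disjoint assms by blast
  have QP: "Q \<times> P \<subseteq> E" using assms(4,5) by (auto dest: symD)
  define L where "L = concat (map (\<lambda>j. [B j, A j]) [0..<t])"
  have BA: "B i \<times> A j \<subseteq> E" "A j \<times> B i \<subseteq> E" if "i < t" "j < t" for i j
    using sub(1)[OF that(2)] sub(2)[OF that(1)] QP assms(4) by blast+
  have "successively (\<lambda>X Y. X \<times> Y \<subseteq> E) L \<and> (t > 0 \<longrightarrow> L \<noteq> [] \<and> hd L = hd [B 0, A 0] \<and>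
      last L = last [B (t - 1), A (t - 1)])"
    unfolding L_def by (rule successively_concat_upt) (use BA in auto)
  then have 1: "successively (\<lambda>X Y. X \<times> Y \<subseteq> E) L" "L \<noteq> []" "hd L = B 0" "last L = A (t - 1)"
    using assms(1) by auto
  have AB: "A i \<inter> B j = {}" "B j \<inter> A i = {}" if "i < t" "j < t" for i j
    using sub(1)[OF that(1)] sub(2)[OF that(2)] PQ by blast+
  have 2: "sorted_wrt (\<lambda>X Y. X \<inter> Y = {}) L"
    unfolding L_def
  proof (rule sorted_wrt_concat_upt)
    show "sorted_wrt (\<lambda>X Y. X \<inter> Y = {}) [B i, A i]" if "i < t" for i using AB[of i i] that by simp
    show "X \<inter> Y = {}" if "i < j" "j < t" "X \<in> set [B i, A i]" "Y \<in> set [B j, A j]" for i j X Y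
    proof -
      have "i < t" using that by simp
      then show ?thesis
        using that(3,4) AB[of i j] AB[of j i] A(3)[OF that(1,2)] B(3)[OF that(1,2)] that(2) by auto
    qed
  qed
  have set_L: "set L = B ` {..<t} \<union> A ` {..<t}" by (auto simp: L_def)
  show ?thesis
  proof (rule that[OF 1(2,1) _ _ 2])
    show "\<Union>(set L) = P \<union> Q" unfolding set_L using A(2) B(2) by auto
    show "lo \<le> card X \<and> card X \<le> hi" if "X \<in> set L" for X
      using that A(1) B(1) unfolding set_L by auto
  qed (use 1 sub assms(1) in auto)
qed

context dense_graph begin

text \<open>
  The links are chosen one after another; \<open>e i\<close> and \<open>f i\<close> are the reserved places at which the path
  enters and leaves the \<open>i\<close>-th pair. The set \<open>D\<close>, which will contain all reserved places, counts as
  used from the start, so that no \<open>Z i\<close> interferes with a reserved place.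
\<close>

lemma select_connectors:
  fixes P Q :: "nat \<Rightarrow> 'a set" and N s L M m p :: nat
  assumes \<C>: "disjoint \<C>" "finite \<C>" "\<And>C. C \<in> \<C> \<Longrightarrow> finite C \<and> card C \<le> M" "\<Union>\<C> = V"
    and s: "s > 0" "M \<le> L * s" "M > 0"
    and e: "\<And>i. i < N \<Longrightarrow> e i \<subseteq> V \<and> card (e i) = p" and f: "\<And>i. i < N \<Longrightarrow> f i \<subseteq> V \<and> card (f i) = p"
    and D: "D \<subseteq> V" "card D \<le> 2 * p * N" "\<And>C. C \<in> \<C> \<Longrightarrow> card (C \<inter> D) \<le> s"
    and m: "m > 0" "2 * real m \<le> \<epsilon> * p" "p > 0"
    and few: "(1 + real L) * real ((2 * p + m) * N) \<le> \<epsilon> / 2 * card V"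
    and large: "real (m * M) * 4 ^ p \<le> \<epsilon> / 8 * card V"
  obtains F X Z where
    "\<And>i. i < N \<Longrightarrow> F i \<subseteq> f i \<and> X i \<subseteq> e (Suc i mod N) \<and> Z i \<subseteq> V - D \<and>
      card (F i) = m \<and> card (X i) = m \<and> card (Z i) = m \<and> F i \<times> Z i \<subseteq> E \<and> Z i \<times> X i \<subseteq> E"
    "\<And>i j. i < j \<Longrightarrow> j < N \<Longrightarrow> Z i \<inter> Z j = {}"
    "\<And>C. C \<in> \<C> \<Longrightarrow> card (C \<inter> (D \<union> (\<Union>i<N. Z i))) \<le> s"
proof -
  define conn where "conn = (\<lambda>i F X Z. F \<subseteq> f i \<and> X \<subseteq> e (Suc i mod N) \<and> Z \<subseteq> V - D \<and>
      card F = m \<and> card X = m \<and> card Z = m \<and> F \<times> Z \<subseteq> E \<and> Z \<times> X \<subseteq> E)"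
  have "\<exists>F X Z. (\<forall>i<k. conn i (F i) (X i) (Z i)) \<and> (\<forall>j<k. \<forall>i<j. Z i \<inter> Z j = {}) \<and>
      (\<forall>C\<in>\<C>. card (C \<inter> (D \<union> (\<Union>i<k. Z i))) \<le> s)" if "k \<le> N" for k
    using that
  proof (induction k)
    case 0
    then show ?case using D(3) by simp
  next
    case (Suc k)
    then have "k \<le> N" by simp
    from Suc.IH[OF this] obtain F X Z where IH: "\<forall>i<k. conn i (F i) (X i) (Z i)" "\<forall>j<k. \<forall>i<j. Z i \<inter> Z j = {}"
      "\<forall>C\<in>\<C>. card (C \<inter> (D \<union> (\<Union>i<k. Z i))) \<le> s" by blast
    define D' where "D' = D \<union> (\<Union>i<k. Z i)"
    have ZV: "Z i \<subseteq> V - D" "card (Z i) = m" if "i < k" for i using IH(1) that by (auto simp: conn_def)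
    have "D' \<subseteq> V" unfolding D'_def using D(1) ZV(1) by blast
    then have D': "D' \<subseteq> V" "finite D'" using finite_V finite_subset[of D' V] by auto
    have "card D' \<le> card D + card (\<Union>i<k. Z i)" unfolding D'_def by (rule card_Un_le)
    also have "card (\<Union>i<k. Z i) \<le> (\<Sum>i<k. card (Z i))" by (rule card_UN_le) simp
    also have "\<dots> = k * m" using ZV(2) by simp
    also have "card D + k * m \<le> 2 * p * N + N * m"
      by (intro add_mono mult_right_mono) (use D(2) Suc.prems in auto)
    finally have cD: "card (\<Union>\<C> \<inter> D') \<le> (2 * p + m) * N"
      using D'(1) by (simp add: \<C>(4) Int_absorb1 algebra_simps)
    define A where "A = available \<C> s D'"
    have A: "A \<subseteq> V - D'" using available_subset[of \<C> s D'] \<C>(4) by (simp add: A_def)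
    have "real (card (V - A)) \<le> 0 + (1 + real L) * real ((2 * p + m) * N)"
      unfolding A_def
      by (rule card_not_available[OF \<C>(1-3) D'(2) s(1,2) finite_V])
        (use \<C>(4) cD in \<open>auto simp flip: of_nat_mult of_nat_add\<close>)
    then have VA: "real (card (V - A)) \<le> \<epsilon> / 2 * card V" using few by linarith
    have kN: "k < N" "Suc k mod N < N" using Suc.prems by auto
    have fe: "f k \<subseteq> V" "card (f k) = p" "e (Suc k mod N) \<subseteq> V" "card (e (Suc k mod N)) = p"
      using e[OF kN(2)] f[OF kN(1)] by auto
    have AV: "A \<subseteq> V" and mM: "m * M > 0" using A m s(3) by auto
    obtain F' X' Z' where conn': "F' \<subseteq> f k" "X' \<subseteq> e (Suc k mod N)" "Z' \<subseteq> A" "card F' = m"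
      "card X' = m" "card Z' = m * M" "F' \<times> Z' \<subseteq> E" "Z' \<times> X' \<subseteq> E"
      by (rule connect[OF AV VA fe m(3) mM m(2) large])
    obtain Y where Y: "Y \<subseteq> Z'" "card Y = m" "\<And>C. C \<in> \<C> \<Longrightarrow> card (C \<inter> (D' \<union> Y)) \<le> s"
      using transversal_pick[OF \<C>(1-3), of D' s Z' m] IH(3) conn'(3,6) s(3)
      by (auto simp: A_def D'_def)
    have YD: "Y \<subseteq> V - D'" using Y(1) conn'(3) A by auto
    have "conn k F' X' Y" unfolding conn_def
      using conn' Y YD by (auto simp: D'_def)
    moreover have "Z i \<inter> Y = {}" if "i < k" for i using YD that by (auto simp: D'_def)
    moreover have "D \<union> (\<Union>i<Suc k. (Z(k := Y)) i) = D' \<union> Y"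
      by (auto simp: D'_def lessThan_Suc)
    ultimately show ?case
      using IH(1,2) Y(3)
      by (intro exI[of _ "F(k := F')"] exI[of _ "X(k := X')"] exI[of _ "Z(k := Y)"])
        (auto simp: less_Suc_eq)
  qed
  from this[of N] obtain F X Z where "\<forall>i<N. conn i (F i) (X i) (Z i)" "\<forall>j<N. \<forall>i<j. Z i \<inter> Z j = {}"
      "\<forall>C\<in>\<C>. card (C \<inter> (D \<union> (\<Union>i<N. Z i))) \<le> s" by blast
  then show ?thesis by (intro that[of F X Z]) (auto simp: conn_def)
qed

text \<open>
  The cycle runs through the \<open>i\<close>-th pair in the zigzag order, starting on the side of \<open>Q i\<close> and
  ending on the side of \<open>P i\<close>, and then moves on through \<open>F i \<subseteq> Q i\<close>, \<open>Z i\<close> and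
  \<open>X i \<subseteq> P (Suc i mod N)\<close>. Every cluster of the pair tiling contributes at most \<open>s\<close> vertices to
  the linking sets, so that the bounds on \<open>lo * t\<close> and \<open>hi * t\<close> allow what is left to be cut into
  \<open>t\<close> parts of admissible size.
\<close>

lemma cyclic_blow_up_of_pair_tiling:
  fixes M s m p t lo hi L :: nat
  assumes \<Q>: "bitiling E (M - s) (M + 1) \<Q>" "covered \<Q> = V"
    and s: "s > 0" "M + 1 \<le> L * s" "2 * s \<le> M" and p: "p > 0" "p \<le> s"
    and m: "m > 0" "2 * real m \<le> \<epsilon> * p"
    and t: "t > 0" "lo * t + 2 * s \<le> M" "M + 1 \<le> hi * t" and lo: "lo \<le> m" "m \<le> hi"
    and few: "(1 + real L) * (2 * real p + real m) \<le> \<epsilon> / 2 * M"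
    and large: "real (m * (M + 1)) * 4 ^ p \<le> \<epsilon> / 8 * card V"
  obtains Cs where "length Cs \<ge> 3" "\<Union>(set Cs) = V" "sorted_wrt (\<lambda>X Y. X \<inter> Y = {}) Cs"
    "successively (\<lambda>X Y. X \<times> Y \<subseteq> E) Cs" "last Cs \<times> hd Cs \<subseteq> E"
    "\<And>X. X \<in> set Cs \<Longrightarrow> lo \<le> card X \<and> card X \<le> hi"
proof -
  obtain qs where qs: "distinct qs" "set qs = \<Q>"
    using finite_distinct_list[OF bitiling_finite[OF \<Q>(1)]] by blast
  define N where "N = length qs"
  define P where "P = (\<lambda>i. fst (qs ! i))"
  define Q where "Q = (\<lambda>i. snd (qs ! i))"
  have PQ: "(P i, Q i) \<in> \<Q>" if "i < N" for i
    using that nth_mem[of i qs] by (simp add: P_def Q_def N_def qs(2))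
  have all: "\<exists>i<N. A = P i \<and> B = Q i" if "(A, B) \<in> \<Q>" for A B
    using that unfolding qs(2)[symmetric] in_set_conv_nth by (auto simp: P_def Q_def N_def)
  have V: "V = (\<Union>i<N. P i \<union> Q i)"
  proof
    show "V \<subseteq> (\<Union>i<N. P i \<union> Q i)"
    proof
      fix v assume "v \<in> V"
      then obtain A B where AB: "(A, B) \<in> \<Q>" "v \<in> A \<union> B"
        unfolding \<Q>(2)[symmetric] covered_def by blast
      then show "v \<in> (\<Union>i<N. P i \<union> Q i)" using all[OF AB(1)] by blast
    qed
    show "(\<Union>i<N. P i \<union> Q i) \<subseteq> V" using bitilingD(6)[OF \<Q>(1) PQ] \<Q>(2) by blast
  qed
  note PQD = bitilingD(1-5)[OF \<Q>(1) PQ]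
  have PV: "P i \<subseteq> V" "Q i \<subseteq> V" if "i < N" for i using V that by auto
  have dPQ: "P i \<inter> Q i = {}" if "i < N" for i
    using irrefl_Times_disjoint[OF irrefl_E PQD(1)[OF that]] .
  have disj: "(P i \<union> Q i) \<inter> (P j \<union> Q j) = {}" if "i < N" "j < N" "i \<noteq> j" for i j
  proof -
    have "qs ! i \<noteq> qs ! j" using that qs(1) by (simp add: N_def nth_eq_iff_index_eq)
    then have "(P i, Q i) \<noteq> (P j, Q j)" by (simp add: P_def Q_def prod_eq_iff)
    then show ?thesis
      using disjoint_family_onD[of "\<lambda>(A, B). A \<union> B" \<Q>, OF _ PQ[OF that(1)] PQ[OF that(2)]] \<Q>(1)
      by (simp add: bitiling_def)
  qed
  have N0: "N > 0" using V V_nonempty by (cases N) auto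
  have NM: "N * M \<le> card V"
  proof -
    have "card V = (\<Sum>(A, B)\<in>\<Q>. card A + card B)"
      using card_covered_eq_sum[OF \<Q>(1) irrefl_E] \<Q>(2) by simp
    also have "\<dots> \<ge> (\<Sum>X\<in>\<Q>. M)"
    proof (rule sum_mono)
      fix X assume "X \<in> \<Q>"
      then show "M \<le> (case X of (A, B) \<Rightarrow> card A + card B)"
        using bitilingD(4,5)[OF \<Q>(1)] s(3) by (cases X) fastforce
    qed
    also have "(\<Sum>X\<in>\<Q>. M) = N * M" using distinct_card[OF qs(1)] qs(2) by (simp add: N_def)
    finally show ?thesis .
  qed
  have "\<exists>e'. e' \<subseteq> P i \<and> card e' = p" "\<exists>f'. f' \<subseteq> Q i \<and> card f' = p" if "i < N" for i
  proof -
    have "p \<le> card (P i)" "p \<le> card (Q i)" using PQD(4,5)[OF that] p(2) s(3) by auto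
    then show "\<exists>e'. e' \<subseteq> P i \<and> card e' = p" "\<exists>f'. f' \<subseteq> Q i \<and> card f' = p"
      by (meson obtain_subset_with_card_n)+
  qed
  then obtain e f where ef: "\<And>i. i < N \<Longrightarrow> e i \<subseteq> P i \<and> card (e i) = p"
    "\<And>i. i < N \<Longrightarrow> f i \<subseteq> Q i \<and> card (f i) = p" by metis
  have fin_ef: "finite (e i)" "finite (f i)" if "i < N" for i
    using ef(1,2)[OF that] PQD(2,3)[OF that] finite_subset by blast+
  define D where "D = (\<Union>i<N. e i \<union> f i)"
  have D_cell: "P i \<inter> D = e i" "Q i \<inter> D = f i" if "i < N" for i
  proof -
    have "P i \<inter> (e j \<union> f j) \<subseteq> e i" "Q i \<inter> (e j \<union> f j) \<subseteq> f i" if "j < N" for j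
      using ef(1,2)[OF that] disj[OF \<open>i < N\<close> that] dPQ[OF \<open>i < N\<close>] by (cases "i = j"; blast)+
    then show "P i \<inter> D = e i" "Q i \<inter> D = f i" using ef(1,2)[OF that] that unfolding D_def by blast+
  qed
  have efD: "e i \<subseteq> D" "f i \<subseteq> D" if "i < N" for i using that by (auto simp: D_def)
  have D: "D \<subseteq> V" using ef PV unfolding D_def by blast
  have cD: "card D \<le> 2 * p * N"
  proof -
    have "card D \<le> (\<Sum>i<N. card (e i \<union> f i))" unfolding D_def by (rule card_UN_le) simp
    also have "\<dots> \<le> (\<Sum>i<N. 2 * p)"
    proof (rule sum_mono)
      fix i assume "i \<in> {..<N}"
      then show "card (e i \<union> f i) \<le> 2 * p" using card_Un_le[of "e i" "f i"] ef[of i] by simp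
    qed
    finally show ?thesis by (simp add: ac_simps)
  qed
  \<comment> \<open>A cluster meets the reserved places only in its own one.\<close>
  have capD: "card (C \<inter> D) \<le> s" if C: "C \<in> cells \<Q>" for C
  proof -
    obtain A B where AB: "(A, B) \<in> \<Q>" "C = A \<or> C = B" using C unfolding cells_iff by blast
    then obtain i where "i < N" "C = P i \<or> C = Q i" using all[OF AB(1)] by auto
    then show ?thesis using D_cell[of i] ef[of i] p(2) by auto
  qed
  have cells: "P i \<in> cells \<Q>" "Q i \<in> cells \<Q>" if "i < N" for i
    using PQ[OF that] unfolding cells_iff by auto
  have few': "(1 + real L) * real ((2 * p + m) * N) \<le> \<epsilon> / 2 * card V"
  proof -
    have "(1 + real L) * real ((2 * p + m) * N) = (1 + real L) * (2 * real p + real m) * N" by simp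
    also have "\<dots> \<le> \<epsilon> / 2 * M * N" by (rule mult_right_mono[OF few]) simp
    also have "\<dots> = \<epsilon> / 2 * real (N * M)" by simp
    also have "\<dots> \<le> \<epsilon> / 2 * card V"
      by (rule mult_left_mono) (use NM \<epsilon>_pos in \<open>auto simp flip: of_nat_mult\<close>)
    finally show ?thesis .
  qed
  have eV: "e i \<subseteq> V \<and> card (e i) = p" "f i \<subseteq> V \<and> card (f i) = p" if "i < N" for i
    using ef(1,2)[OF that] PV[OF that] by auto
  have U: "\<Union>(cells \<Q>) = V" using \<Q>(2) by simp
  obtain F X Z where conn: "\<And>i. i < N \<Longrightarrow> F i \<subseteq> f i \<and> X i \<subseteq> e (Suc i mod N) \<and> Z i \<subseteq> V - D \<and>
      card (F i) = m \<and> card (X i) = m \<and> card (Z i) = m \<and> F i \<times> Z i \<subseteq> E \<and> Z i \<times> X i \<subseteq> E"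
    and Zdisj: "\<And>i j. i < j \<Longrightarrow> j < N \<Longrightarrow> Z i \<inter> Z j = {}"
    and cap: "\<And>C. C \<in> cells \<Q> \<Longrightarrow> card (C \<inter> (D \<union> (\<Union>i<N. Z i))) \<le> s"
  proof (rule select_connectors[of "cells \<Q>" "M + 1" s L N e p f D m])
    show "disjoint (cells \<Q>)" by (rule disjoint_cells[OF \<Q>(1) irrefl_E])
    show "finite (cells \<Q>)" by (rule finite_cells[OF \<Q>(1)])
    show "finite C \<and> card C \<le> M + 1" if "C \<in> cells \<Q>" for C by (rule cellsD[OF \<Q>(1) that])
    show "e i \<subseteq> V \<and> card (e i) = p" "f i \<subseteq> V \<and> card (f i) = p" if "i < N" for i
      using eV[OF that] by auto
    show "card (C \<inter> D) \<le> s" if "C \<in> cells \<Q>" for C using capD[OF that] .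
  qed (rule U s(1,2) D cD m p(1) few' large zero_less_Suc that | simp)+
  define used where "used = (\<Union>i<N. F i \<union> Z i \<union> X i)"
  have succ: "Suc i mod N < N" for i using N0 by simp
  have used_sub: "used \<subseteq> D \<union> (\<Union>i<N. Z i)"
    unfolding used_def
  proof (rule UN_least)
    fix i assume "i \<in> {..<N}"
    then have i: "i < N" by simp
    have "F i \<subseteq> D" "X i \<subseteq> D" using conn[OF i] efD(2)[OF i] efD(1)[OF succ, of i] by auto
    then show "F i \<union> Z i \<union> X i \<subseteq> D \<union> (\<Union>i<N. Z i)" using i by auto
  qed
  have "(\<Union>i<N. Z i) \<subseteq> V"
  proof (rule UN_least)
    show "Z i \<subseteq> V" if "i \<in> {..<N}" for i using conn[of i] that by auto
  qed
  with D have "D \<union> (\<Union>i<N. Z i) \<subseteq> V" by (rule Un_least)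
  with used_sub have usedV: "used \<subseteq> V" by (rule subset_trans)
  have size: "lo * t \<le> card (C - used) \<and> card (C - used) \<le> hi * t"
    if "C \<in> cells \<Q>" "finite C" "card C \<in> {M - s..M + 1}" for C
  proof -
    have "C \<inter> used \<subseteq> C \<inter> (D \<union> (\<Union>i<N. Z i))" using used_sub by blast
    then have "card (C \<inter> used) \<le> card (C \<inter> (D \<union> (\<Union>i<N. Z i)))"
      by (rule card_mono[rotated]) (use that in simp)
    then have "card (C \<inter> used) \<le> s" using cap[OF that(1)] by simp
    moreover have "card (C - used) = card C - card (C \<inter> used)"
      by (rule card_Diff_subset_Int) (use that in simp)
    ultimately show ?thesis using that(3) t s(3) by auto
  qed
  have lohi: "lo \<le> hi" using lo by simp
  have "\<exists>Ls. Ls \<noteq> [] \<and> successively (\<lambda>X Y. X \<times> Y \<subseteq> E) Ls \<and> hd Ls \<subseteq> Q i - used \<and>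
      last Ls \<subseteq> P i - used \<and> sorted_wrt (\<lambda>X Y. X \<inter> Y = {}) Ls \<and>
      \<Union>(set Ls) = (P i - used) \<union> (Q i - used) \<and> (\<forall>X\<in>set Ls. lo \<le> card X \<and> card X \<le> hi)"
    if "i < N" for i
  proof -
    have "(P i - used) \<times> (Q i - used) \<subseteq> E" using PQD(1)[OF that] by blast
    moreover note size[OF cells(1)[OF that] PQD(2,4)[OF that]] size[OF cells(2)[OF that] PQD(3,5)[OF that]]
    ultimately show ?thesis
      using zigzag[of t "P i - used" "Q i - used" E lo hi] t(1) sym_E irrefl_E lohi PQD(2,3)[OF that]
      by (metis finite_Diff)
  qed
  then obtain mid where mid: "\<And>i. i < N \<Longrightarrow> mid i \<noteq> [] \<and> successively (\<lambda>X Y. X \<times> Y \<subseteq> E) (mid i) \<and>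
      hd (mid i) \<subseteq> Q i - used \<and> last (mid i) \<subseteq> P i - used \<and>
      sorted_wrt (\<lambda>X Y. X \<inter> Y = {}) (mid i) \<and> \<Union>(set (mid i)) = (P i - used) \<union> (Q i - used) \<and>
      (\<forall>X\<in>set (mid i). lo \<le> card X \<and> card X \<le> hi)" by metis
  define piece where "piece = (\<lambda>i. mid i @ [F i, Z i, X i])"
  define Cs where "Cs = concat (map piece [0..<N])"
  have FQ: "F i \<subseteq> Q i" "F i \<subseteq> D" "X i \<subseteq> P (Suc i mod N)" "X i \<subseteq> D" "Z i \<inter> D = {}" "Z i \<subseteq> V"
    "F i \<subseteq> used" "Z i \<subseteq> used" "X i \<subseteq> used"
    if "i < N" for i
  proof -
    note c = conn[OF that]
    show "F i \<subseteq> Q i" "F i \<subseteq> D" using c ef(2)[OF that] efD(2)[OF that] by auto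
    show "X i \<subseteq> P (Suc i mod N)" "X i \<subseteq> D" using c ef(1)[OF succ, of i] efD(1)[OF succ, of i] by auto
    show "Z i \<inter> D = {}" "Z i \<subseteq> V" using c by auto
    show "F i \<subseteq> used" "Z i \<subseteq> used" "X i \<subseteq> used" using that by (auto simp: used_def)
  qed
  have FX: "F i \<inter> X j = {}" if "i < N" "j < N" for i j
  proof (cases "i = Suc j mod N")
    case True
    then show ?thesis using FQ(1)[OF that(1)] FQ(3)[OF that(2)] dPQ[OF that(1)] by blast
  next
    case False
    then show ?thesis
      using FQ(1)[OF that(1)] FQ(3)[OF that(2)] disj[OF that(1) succ, of j] by blast
  qed
  have XX: "X i \<inter> X j = {}" if "i < j" "j < N" for i j
  proof -
    \<comment> \<open>\<open>X i\<close> and \<open>X j\<close> lie in different pairs.\<close>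
    have "Suc i mod N \<noteq> Suc j mod N" using that by (auto simp: mod_Suc)
    then show ?thesis
      using FQ(3)[of i] FQ(3)[OF that(2)] disj[OF succ succ, of i j] that by auto
  qed
  have FF: "F i \<inter> F j = {}" if "i < j" "j < N" for i j
    using FQ(1)[of i] FQ(1)[OF that(2)] disj[of i j] that by auto
  have FZ: "F i \<inter> Z j = {}" "X i \<inter> Z j = {}" if "i < N" "j < N" for i j
    using FQ(2,4)[OF that(1)] FQ(5)[OF that(2)] by blast+
  have mid_sub: "Y \<subseteq> (P i \<union> Q i) - used" if "i < N" "Y \<in> set (mid i)" for i Y
    using mid[OF that(1)] that(2) by blast
  have "successively (\<lambda>X Y. X \<times> Y \<subseteq> E) Cs \<and> (N > 0 \<longrightarrow> Cs \<noteq> [] \<and> hd Cs = hd (piece 0) \<and>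
      last Cs = last (piece (N - 1)))"
    unfolding Cs_def
  proof (rule successively_concat_upt)
    fix i assume i: "i < N"
    have "last (mid i) \<times> F i \<subseteq> E" using mid[OF i] FQ(1)[OF i] PQD(1)[OF i] by blast
    then show "piece i \<noteq> [] \<and> successively (\<lambda>X Y. X \<times> Y \<subseteq> E) (piece i)"
      using mid[OF i] conn[OF i] by (simp add: piece_def successively_append_iff)
  next
    fix i assume i: "Suc i < N"
    then have "X i \<subseteq> P (Suc i)" using FQ(3)[of i] by simp
    then have "X i \<times> hd (mid (Suc i)) \<subseteq> E" using mid[OF i] PQD(1)[OF i] by blast
    then show "last (piece i) \<times> hd (piece (Suc i)) \<subseteq> E"
      using mid[OF i] by (simp add: piece_def)
  qed
  then have succ_Cs: "successively (\<lambda>X Y. X \<times> Y \<subseteq> E) Cs" "hd Cs = hd (mid 0)" "last Cs = X (N - 1)"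
    using N0 mid[OF N0] by (auto simp: piece_def)
  have set_Cs: "set Cs = (\<Union>i<N. set (mid i) \<union> {F i, Z i, X i})"
    by (auto simp: Cs_def piece_def)
  have close: "last Cs \<times> hd Cs \<subseteq> E"
  proof -
    have "X (N - 1) \<subseteq> P 0" using FQ(3)[of "N - 1"] N0 by simp
    then show ?thesis using mid[OF N0] PQD(1)[OF N0] unfolding succ_Cs by blast
  qed
  have sorted: "sorted_wrt (\<lambda>X Y. X \<inter> Y = {}) Cs"
    unfolding Cs_def
  proof (rule sorted_wrt_concat_upt)
    fix i assume i: "i < N"
    have "Y \<inter> W = {}" if "Y \<in> set (mid i)" "W \<in> {F i, Z i, X i}" for Y W
      using mid_sub[OF i that(1)] FQ(7-9)[OF i] that(2) by blast
    moreover have "Z i \<inter> X i = {}" using FZ(2)[OF i i] by blast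
    ultimately show "sorted_wrt (\<lambda>X Y. X \<inter> Y = {}) (piece i)"
      using mid[OF i] FX[OF i i] FZ(1)[OF i i] by (simp add: piece_def sorted_wrt_append)
  next
    fix i j Y W assume ij: "i < j" "j < N" "Y \<in> set (piece i)" "W \<in> set (piece j)"
    then have i: "i < N" by simp
    have *: "Y \<in> set (mid i) \<or> Y \<in> {F i, Z i, X i}" "W \<in> set (mid j) \<or> W \<in> {F j, Z j, X j}"
      using ij(3,4) by (auto simp: piece_def)
    consider "Y \<in> set (mid i)" "W \<in> set (mid j)" | "Y \<in> set (mid i)" "W \<in> {F j, Z j, X j}"
      | "Y \<in> {F i, Z i, X i}" "W \<in> set (mid j)" | "Y \<in> {F i, Z i, X i}" "W \<in> {F j, Z j, X j}"
      using * by argo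
    then show "Y \<inter> W = {}"
    proof cases
      case 1
      then show ?thesis
        using mid_sub[OF i 1(1)] mid_sub[OF ij(2) 1(2)] disj[OF i ij(2)] ij(1) by blast
    next
      case 2
      then show ?thesis using mid_sub[OF i 2(1)] FQ(7-9)[OF ij(2)] by blast
    next
      case 3
      then show ?thesis using mid_sub[OF ij(2) 3(2)] FQ(7-9)[OF i] by blast
    next
      case 4
      have "Z i \<inter> F j = {}" "Z i \<inter> X j = {}" "X i \<inter> F j = {}"
        using FZ[OF ij(2) i] FX[OF ij(2) i] by blast+
      then show ?thesis
        using 4 FF[OF ij(1,2)] XX[OF ij(1,2)] Zdisj[OF ij(1,2)] FX[OF i ij(2)] FZ[OF i ij(2)]
        by (elim insertE emptyE) simp_all
    qed
  qed
  have union: "\<Union>(set Cs) = V"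
  proof
    have "\<Union>(set (mid i)) \<subseteq> V" if "i < N" for i using mid[OF that] PV[OF that] by blast
    then show "\<Union>(set Cs) \<subseteq> V" unfolding set_Cs using FQ(7-9) usedV by blast
    show "V \<subseteq> \<Union>(set Cs)"
    proof
      fix v assume v: "v \<in> V"
      show "v \<in> \<Union>(set Cs)"
      proof (cases "v \<in> used")
        case True
        then show ?thesis unfolding set_Cs used_def by blast
      next
        case False
        then obtain i where "i < N" "v \<in> (P i - used) \<union> (Q i - used)" using v V by blast
        then have "i < N" "v \<in> \<Union>(set (mid i))" using mid by blast+
        then show ?thesis unfolding set_Cs by blast
      qed
    qed
  qed
  have sizes: "lo \<le> card Y \<and> card Y \<le> hi" if "Y \<in> set Cs" for Y
  proof -
    obtain i where i: "i < N" "Y \<in> set (mid i) \<or> Y \<in> {F i, Z i, X i}"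
      using \<open>Y \<in> set Cs\<close> unfolding set_Cs by auto
    then show ?thesis using conn[OF i(1)] mid[OF i(1)] lo by auto
  qed
  have "length (piece 0) \<le> length Cs"
  proof -
    have "[0..<N] = 0 # [1..<N]" using N0 by (simp add: upt_conv_Cons)
    then show ?thesis by (simp add: Cs_def)
  qed
  then have "length Cs \<ge> 3" by (simp add: piece_def)
  then show ?thesis using that union sorted succ_Cs(1) close sizes by blast
qed

end

section \<open>From the list of clusters to the theorem\<close>

text \<open>
  All sizes are multiples of \<open>w\<close>: links have size \<open>m = h w\<close>, sides of pairs have size about
  \<open>M = 4 t m\<close> and are cut into \<open>4 t\<close> parts, and a cluster may lose up to \<open>s = t w\<close> vertices in
  each of the two rounds, absorption and linking. The total loss \<open>2 t w\<close> changes each of the \<open>4 t\<close>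
  parts by less than \<open>w\<close>, which is the proportion \<open>1 / h\<close> of its size.
\<close>

lemma (in dense_graph) blow_up_at_scale:
  fixes \<gamma> :: real and r k h w t :: nat
  assumes \<gamma>: "0 < \<gamma>" "\<gamma> \<le> 1 / 2" "(4 * real h + 2) * \<gamma> \<le> \<epsilon> / 4"
    and r: "2 \<le> \<epsilon> * r" and k: "4 * (r + 1) \<le> \<epsilon> * k"
    and h: "h \<ge> 2" and t: "t = r * (2 * h + 1) * (2 * r + 1)" and w: "w > 0"
    and large: "16 ^ (r ^ k * (4 * t * h * w)) \<le> \<epsilon> * \<gamma> / 4 * card V"
  obtains Cs where "length Cs \<ge> 3" "\<Union>(set Cs) = V" "sorted_wrt (\<lambda>X Y. X \<inter> Y = {}) Cs"
    "successively (\<lambda>X Y. X \<times> Y \<subseteq> E) Cs" "last Cs \<times> hd Cs \<subseteq> E"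
    "\<And>X. X \<in> set Cs \<Longrightarrow> (h - 1) * w \<le> card X \<and> card X \<le> h * w + 1"
proof -
  have r0: "r > 0" using r by (cases r) auto
  have t0: "t > 0" using r0 by (simp add: t)
  define s where "s = t * w"
  define m where "m = h * w"
  define M where "M = (4 * h) * s"
  define p where "p = r * m"
  have M': "M = 4 * t * h * w" by (simp add: M_def s_def)
  have s0: "s > 0" and m0: "m > 0" and p0: "p > 0"
    using t0 w h r0 by (simp_all add: s_def m_def p_def)
  have ht: "r * h \<le> t" unfolding t mult.assoc by (intro mult_le_mono2) simp
  have ps: "p \<le> s"
    using mult_right_mono[OF ht, of w] by (simp add: p_def m_def s_def algebra_simps)
  have sM: "8 * s \<le> M" using h by (simp add: M_def)
  have large': "16 ^ (r ^ k * M) \<le> \<epsilon> * \<gamma> / 4 * card V" using large by (simp add: M')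
  have g: "(real (4 * h) + 2) * \<gamma> \<le> \<epsilon> / 4" using \<gamma>(3) by simp
  have h0: "4 * h > 0" using h by simp
  obtain \<Q> where \<Q>: "bitiling E (M - s) (M + 1) \<Q>" "covered \<Q> = V"
    by (rule perfect_pair_tiling[OF \<gamma>(1,2) g r k s0 M_def h0 large'])
  have "M + 1 \<le> (4 * h + 1) * s" using s0 by (simp add: M_def algebra_simps)
  moreover have "2 * s \<le> M" using sM by simp
  moreover have "2 * real m \<le> \<epsilon> * p"
    using mult_right_mono[OF r, of m] by (simp add: p_def)
  moreover have "(h - 1) * w * (4 * t) + 2 * s \<le> M"
  proof -
    obtain h' where h': "h = Suc h'" using h by (cases h) auto
    show ?thesis by (simp add: M_def s_def h' algebra_simps)
  qed
  moreover have "M + 1 \<le> (h * w + 1) * (4 * t)"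
    using t0 by (simp add: M_def s_def algebra_simps)
  moreover have "(h - 1) * w \<le> m" "m \<le> h * w + 1" by (auto simp: m_def)
  moreover have "(1 + real (4 * h + 1)) * (2 * real p + real m) \<le> \<epsilon> / 2 * M"
  proof -
    have "(1 + real (4 * h + 1)) * (2 * real p + real m)
        = 2 * ((2 * real h + 1) * (2 * real r + 1) * real m)"
      by (simp add: p_def algebra_simps)
    also have "\<dots> \<le> (\<epsilon> * r) * ((2 * real h + 1) * (2 * real r + 1) * real m)"
      by (rule mult_right_mono[OF r]) simp
    also have "\<dots> = \<epsilon> * (real t * m)" by (simp add: t algebra_simps)
    also have "\<dots> \<le> \<epsilon> * (2 * real t * m)"
      using \<epsilon>_pos by (intro mult_left_mono) auto
    also have "\<dots> = \<epsilon> / 2 * M" by (simp add: M_def s_def m_def)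
    finally show ?thesis .
  qed
  moreover have "real (m * (M + 1)) * 4 ^ p \<le> \<epsilon> / 8 * card V"
  proof -
    have x: "M \<le> r ^ k * M" using r0 by simp
    have mt: "m \<le> M" unfolding M' m_def using t0 by simp
    have "p \<le> M" using ps sM by simp
    moreover have "M < 2 ^ M" by (rule less_exp)
    then have "m \<le> 2 ^ M" "M + 1 \<le> 2 ^ M" using mt by linarith+
    ultimately have "m * (M + 1) * 4 ^ p \<le> 2 ^ M * 2 ^ M * 4 ^ M"
      by (intro mult_mono power_increasing) auto
    also have "\<dots> = (16::nat) ^ M" by (simp flip: power_mult_distrib)
    also have "\<dots> \<le> 16 ^ (r ^ k * M)" using x by (rule power_increasing) simp
    finally have "real (m * (M + 1) * 4 ^ p) \<le> real (16 ^ (r ^ k * M))" by (simp only: of_nat_le_iff)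
    then have "real (m * (M + 1)) * 4 ^ p \<le> \<epsilon> * \<gamma> / 4 * card V" using large' by simp
    also have "\<dots> \<le> \<epsilon> / 8 * card V"
      using mult_left_mono[OF \<gamma>(2), of "\<epsilon> / 4"] \<epsilon>_pos by (intro mult_right_mono) auto
    finally show ?thesis .
  qed
  ultimately show ?thesis
    using cyclic_blow_up_of_pair_tiling[OF \<Q> s0 _ _ p0 ps m0] t0 that by (metis mult_pos_pos zero_less_numeral)
qed

lemma out_degree_eq_card_neighbours:
  assumes "pair_graph G"
  shows "out_degree (with_proj G) v = card (parcs G `` {v})"
proof -
  have "out_arcs (with_proj G) v = Pair v ` (parcs G `` {v})"
    by (force simp: out_arcs_def)
  then show ?thesis by (simp add: out_degree_def card_image inj_on_def)
qed

lemma dense_graph_of_min_degree: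
  assumes "pair_graph G" "pverts G \<noteq> {}" "\<epsilon> > 0"
    and "(1 / 2 + \<epsilon>) * real (card (pverts G)) \<le> real (min_degree G)"
  shows "dense_graph (pverts G) (parcs G) \<epsilon>"
proof -
  interpret pair_graph G by fact
  show ?thesis
  proof
    show "parcs G \<subseteq> pverts G \<times> pverts G" using in_arcsD1 in_arcsD2 by auto
    show "sym (parcs G)" using pair_sym_arcs by (auto simp: symmetric_def)
    show "irrefl (parcs G)" using no_loops' by (auto simp: irrefl_def)
    fix v assume "v \<in> pverts G"
    then have "min_degree G \<le> out_degree (with_proj G) v"
      unfolding min_degree_def using pair_finite_verts by (intro Min_le) auto
    then show "(1 / 2 + \<epsilon>) * real (card (pverts G)) \<le> real (card (parcs G `` {v}))"
      using assms(4) by (simp add: out_degree_eq_card_neighbours[OF assms(1)])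
  qed (use assms pair_finite_verts in auto)
qed

text \<open>
  Translates the list of clusters into the blow-up of \<open>cycle_graph\<close>: the arcs of this graph are the
  pairs of cyclically consecutive indices, in both directions.
\<close>

lemma cyclic_list_gives_blow_up:
  assumes G: "pair_graph G" and k: "length Cs \<ge> 3"
    and V: "\<Union>(set Cs) = pverts G" and disj: "sorted_wrt (\<lambda>X Y. X \<inter> Y = {}) Cs"
    and succ: "successively (\<lambda>X Y. X \<times> Y \<subseteq> parcs G) Cs" "last Cs \<times> hd Cs \<subseteq> parcs G"
    and ne: "\<And>X. X \<in> set Cs \<Longrightarrow> X \<noteq> {}"
  obtains H where "is_blow_up (cycle_graph (length Cs)) (nth Cs) H"
    "spanning (with_proj H) (with_proj G)"
proof -
  interpret G: pair_graph G by fact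
  define F where "F = cycle_graph (length Cs)"
  define H where "H = \<lparr> pverts = \<Union>v\<in>pverts F. Cs ! v, parcs = \<Union>(u, v)\<in>parcs F. Cs ! u \<times> Cs ! v \<rparr>"
  have vF: "pverts F = {..<length Cs}" by (simp add: F_def cycle_graph_def)
  have set: "set Cs = nth Cs ` {..<length Cs}" by (auto simp: set_conv_nth)
  have vH: "pverts H = pverts G" using V by (simp add: H_def vF set)
  have blow: "is_blow_up F (nth Cs) H"
    unfolding is_blow_up_def
  proof (intro conjI)
    show "disjoint_family_on ((!) Cs) (pverts F)"
      unfolding disjoint_family_on_def vF
    proof (intro ballI impI)
      fix i j assume "i \<in> {..<length Cs}" "j \<in> {..<length Cs}" "i \<noteq> j"
      then show "Cs ! i \<inter> Cs ! j = {}"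
        using sorted_wrt_nth_less[OF disj, of i j] sorted_wrt_nth_less[OF disj, of j i]
        by (cases "i < j") auto
    qed
    show "\<forall>v\<in>pverts F. Cs ! v \<noteq> {}" using ne by (auto simp: vF)
  qed (simp_all add: H_def)
  have edge: "Cs ! i \<times> Cs ! (Suc i mod length Cs) \<subseteq> parcs G" if "i < length Cs" for i
  proof (cases "Suc i < length Cs")
    case True
    then show ?thesis using succ(1) by (simp add: successively_conv_nth)
  next
    case False
    then have "Suc i = length Cs" using that by simp
    then have "i = length Cs - 1" by simp
    moreover have "Cs \<noteq> []" using k by auto
    ultimately show ?thesis using succ(2) \<open>Suc i = length Cs\<close> by (simp add: last_conv_nth hd_conv_nth)
  qed
  have symG: "(y, x) \<in> parcs G" if "(x, y) \<in> parcs G" for x y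
    using that G.pair_sym_arcs by (auto simp: symmetric_def dest: symD)
  have aH: "parcs H \<subseteq> parcs G"
  proof
    fix a assume "a \<in> parcs H"
    then obtain i j x y where a: "a = (x, y)" "x \<in> Cs ! i" "y \<in> Cs ! j" "(i, j) \<in> parcs F"
      by (auto simp: H_def)
    then have ij: "i < length Cs" "j < length Cs" "j = Suc i mod length Cs \<or> i = Suc j mod length Cs"
      by (auto simp: F_def cycle_graph_def)
    from ij(3) show "a \<in> parcs G"
    proof
      assume "j = Suc i mod length Cs"
      then show ?thesis using edge[OF ij(1)] a by auto
    next
      assume "i = Suc j mod length Cs"
      then have "(y, x) \<in> parcs G" using edge[OF ij(2)] a by auto
      then show ?thesis using symG a by simp
    qed
  qed
  have "finite (Cs ! v)" if "v \<in> pverts F" for v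
  proof -
    have "Cs ! v \<subseteq> pverts G" using that V by (auto simp: vF set)
    then show ?thesis using G.pair_finite_verts finite_subset by blast
  qed
  then have "pair_graph H"
    using pair_graph_blow_up[OF _ blow] pair_graph_cycle_graph[OF k] by (simp add: F_def)
  then interpret H: pair_graph H .
  have "spanning (with_proj H) (with_proj G)"
    unfolding spanning_def subgraph_def compatible_def
    using vH aH G.wf_digraph H.wf_digraph by simp
  then show ?thesis using that blow by (simp add: F_def)
qed

theorem theorem1p1:
  fixes \<epsilon> \<eta> :: real
  assumes "\<epsilon> > 0" and "\<eta> > 0"
  shows "\<exists>c::real. \<exists>n\<^sub>0::nat. c > 0 \<and>
    (\<forall>(G :: 'a pair_pre_digraph) n.
       pair_graph G \<and> card (pverts G) = n \<and> n \<ge> n\<^sub>0 \<and>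
       real (min_degree G) \<ge> (1/2 + \<epsilon>) * real n \<longrightarrow>
       (\<exists>k C H. k \<ge> 3 \<and> is_blow_up (cycle_graph k) C H \<and>
          spanning (with_proj H) (with_proj G) \<and>
          (\<forall>i\<in>pverts (cycle_graph k).
             (1 - \<eta>) * c * ln (real n) \<le> real (card (C i)) \<and>
             real (card (C i)) \<le> (1 + \<eta>) * c * ln (real n))))"
proof -
  obtain r :: nat where r: "2 / \<epsilon> \<le> r" using real_arch_simple by blast
  obtain h' :: nat where h': "2 / \<eta> \<le> h'" using real_arch_simple by blast
  define h where "h = h' + 2"
  obtain k :: nat where k: "4 * (real r + 1) / \<epsilon> \<le> k" using real_arch_simple by blast
  define t where "t = r * (2 * h + 1) * (2 * r + 1)"
  define \<gamma> where "\<gamma> = min (1 / 2) (\<epsilon> / (4 * (4 * real h + 2)))"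
  define R where "R = r ^ k * (4 * t * h)"
  \<comment> \<open>The factor 2 makes \<open>16 ^ (R * w)\<close> at most the square root of \<open>n\<close>, which leaves room for the
    constant \<open>\<epsilon> * \<gamma> / 4\<close>.\<close>
  define c where "c = 1 / (2 * R * ln 16)"
  \<comment> \<open>The exponential bound makes \<open>w\<close> large enough for the rounding errors.\<close>
  define n\<^sub>0 where "n\<^sub>0 = max 1 (nat \<lceil>max (exp (h / c)) ((4 / (\<epsilon> * \<gamma>))\<^sup>2)\<rceil>)"
  have r2: "2 \<le> \<epsilon> * r" using r assms by (simp add: field_simps)
  have k2: "4 * (r + 1) \<le> \<epsilon> * k" using k assms by (simp add: field_simps)
  have h2: "h \<ge> 2" "2 \<le> \<eta> * h" using h' assms by (auto simp: h_def field_simps)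
  have r0: "r > 0" using r2 by (cases r) auto
  have t0: "t > 0" using r0 by (simp add: t_def)
  have R0: "R > 0" using r0 t0 h2 by (simp add: R_def)
  have c0: "c > 0" using R0 by (simp add: c_def)
  have \<gamma>: "0 < \<gamma>" "\<gamma> \<le> 1 / 2" "(4 * real h + 2) * \<gamma> \<le> \<epsilon> / 4"
  proof -
    show "0 < \<gamma>" using assms by (auto simp: \<gamma>_def intro!: divide_pos_pos add_nonneg_pos)
    show "\<gamma> \<le> 1 / 2" unfolding \<gamma>_def by (rule min.cobounded1)
    have "(4 * real h + 2) * \<gamma> \<le> (4 * real h + 2) * (\<epsilon> / (4 * (4 * real h + 2)))"
      by (rule mult_left_mono) (auto simp: \<gamma>_def)
    also have "\<dots> = \<epsilon> / 4" by (simp add: field_simps add_nonneg_eq_0_iff)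
    finally show "(4 * real h + 2) * \<gamma> \<le> \<epsilon> / 4" .
  qed
  have main: "\<exists>k C H. k \<ge> 3 \<and> is_blow_up (cycle_graph k) C H \<and>
          spanning (with_proj H) (with_proj G) \<and>
          (\<forall>i\<in>pverts (cycle_graph k).
             (1 - \<eta>) * (h * c) * ln (real n) \<le> real (card (C i)) \<and>
             real (card (C i)) \<le> (1 + \<eta>) * (h * c) * ln (real n))"
    if G: "pair_graph G" "card (pverts G) = n" "n \<ge> n\<^sub>0"
      "real (min_degree G) \<ge> (1/2 + \<epsilon>) * real n" for G :: "'a pair_pre_digraph" and n
  proof -
    have n: "n \<ge> 1" "exp (h / c) \<le> n" "(4 / (\<epsilon> * \<gamma>))\<^sup>2 \<le> n"
      using G(3) by (auto simp: n\<^sub>0_def nat_le_iff ceiling_le_iff)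
    have ne: "pverts G \<noteq> {}" using G(2) n(1) by auto
    interpret dense_graph "pverts G" "parcs G" \<epsilon>
      by (rule dense_graph_of_min_degree) (use G ne assms in auto)
    define x where "x = c * ln n"
    define w where "w = nat \<lfloor>x\<rfloor>"
    have "h / c \<le> ln n" using n(1,2) by (subst ln_ge_iff) auto
    then have x: "h \<le> x" using c0 by (simp add: x_def field_simps)
    have w: "real w \<le> x" "x < real w + 1" using x by (auto simp: w_def)
    have "1 \<le> w" using x h2 w by linarith
    have "16 ^ (R * w) \<le> sqrt n"
    proof -
      have "R * w * ln 16 \<le> R * x * ln 16"
        using mult_left_mono[OF w(1), of "real R"] by (intro mult_right_mono) simp_all
      also have "\<dots> = ln n / 2" using R0 by (simp add: x_def c_def)
      also have "\<dots> = ln (sqrt n)" using n(1) by (simp add: ln_sqrt)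
      finally have "exp (R * w * ln 16) \<le> exp (ln (sqrt n))" by simp
      moreover have "exp (R * w * ln 16) = 16 ^ (R * w)"
        by (metis exp_ln exp_of_nat_mult of_nat_mult zero_less_numeral)
      ultimately show ?thesis using n(1) by simp
    qed
    also have "sqrt n \<le> \<epsilon> * \<gamma> / 4 * n"
    proof -
      have "4 / (\<epsilon> * \<gamma>) \<le> sqrt n" using n(3) by (rule real_le_rsqrt)
      then have "1 \<le> \<epsilon> * \<gamma> / 4 * sqrt n" using assms \<gamma> by (simp add: field_simps)
      then have "1 * sqrt n \<le> \<epsilon> * \<gamma> / 4 * sqrt n * sqrt n" by (rule mult_right_mono) simp
      then show ?thesis by (simp add: mult.assoc)
    qed
    finally have large: "16 ^ (r ^ k * (4 * t * h * w)) \<le> \<epsilon> * \<gamma> / 4 * card (pverts G)"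
      using G(2) by (simp add: R_def mult.assoc)
    obtain Cs where Cs: "length Cs \<ge> 3" "\<Union>(set Cs) = pverts G" "sorted_wrt (\<lambda>X Y. X \<inter> Y = {}) Cs"
      "successively (\<lambda>X Y. X \<times> Y \<subseteq> parcs G) Cs" "last Cs \<times> hd Cs \<subseteq> parcs G"
      "\<And>X. X \<in> set Cs \<Longrightarrow> (h - 1) * w \<le> card X \<and> card X \<le> h * w + 1"
      using blow_up_at_scale[OF \<gamma> r2 k2 h2(1) t_def _ large] \<open>1 \<le> w\<close> by auto
    have lower: "0 < (h - 1) * w" using h2 \<open>1 \<le> w\<close> by simp
    have "X \<noteq> {}" if "X \<in> set Cs" for X using Cs(6)[OF that] lower by auto
    then obtain H where H: "is_blow_up (cycle_graph (length Cs)) (nth Cs) H"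
      "spanning (with_proj H) (with_proj G)"
      using cyclic_list_gives_blow_up[OF G(1) Cs(1-5)] by blast
    have "(1 - \<eta>) * (h * c) * ln n \<le> card X \<and> card X \<le> (1 + \<eta>) * (h * c) * ln n"
      if "X \<in> set Cs" for X
    proof
      have x1: "1 \<le> x" using x h2 by linarith
      have "2 * x \<le> \<eta> * h * x" by (rule mult_right_mono[OF h2(2)]) (use x1 in simp)
      then have a: "\<eta> * h * x \<ge> 2 * x" .
      have "(1 - \<eta>) * (h * c) * ln n = h * x - \<eta> * h * x" by (simp add: x_def algebra_simps)
      also have "\<dots> \<le> h * x - x - h + 1" using a x by linarith
      also have "\<dots> = (real h - 1) * (x - 1)" by (simp add: algebra_simps)
      also have "\<dots> \<le> (real h - 1) * w" by (rule mult_left_mono) (use w h2 in auto)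
      also have "\<dots> = real ((h - 1) * w)" using h2 by (simp add: of_nat_diff)
      also have "\<dots> \<le> card X" using Cs(6)[OF that] by (simp only: of_nat_le_iff)
      finally show "(1 - \<eta>) * (h * c) * ln n \<le> card X" .
      have "real (card X) \<le> real (h * w + 1)" using Cs(6)[OF that] by (simp only: of_nat_le_iff)
      also have "\<dots> \<le> h * x + 1" using mult_left_mono[OF w(1), of h] by simp
      also have "\<dots> \<le> h * x + \<eta> * h * x" using a x1 by linarith
      also have "\<dots> = (1 + \<eta>) * (h * c) * ln n" by (simp add: x_def algebra_simps)
      finally show "card X \<le> (1 + \<eta>) * (h * c) * ln n" .
    qed
    then show ?thesis
      using H Cs(1) by (intro exI[of _ "length Cs"] exI[of _ "nth Cs"] exI[of _ H])
        (auto simp: cycle_graph_def)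
  qed
  show ?thesis
  proof (rule exI[of _ "h * c"], rule exI[of _ n\<^sub>0], intro conjI allI impI)
    show "0 < h * c" using c0 h2 by simp
  qed (elim conjE, rule main)
qed

end
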